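(* (i) If $f\in \mathcal{S}\cap \dot W^{1,2}(\mathbb{C},\mathbb{C})$, then $$\int_{\mathbb{C}} L(\partial f,\overline{\partial} f)\ge 0.$$ (ii) If $1<p<\infty$ and $f\in \mathcal{S}\cap \dot W^{1,p}(\mathbb{C},\mathbb{C})$, then $$\int_{\mathbb{C}} \Phi_p(\partial f,\overline{\partial} f)\ge 0.$$
   Context: For $f:\mathbb{C}\to\mathbb{C}$, with $z=x+iy$, the formal complex derivatives are $\partial f=\frac12\left(\frac{\partial f}{\partial x}-i\frac{\partial f}{\partial y}\right)$ and $\overline{\partial} f=\frac12\left(\frac{\partial f}{\partial x}+i\frac{\partial f}{\partial y}\right)$. $\dot W^{1,p}(\mathbb{C},\mathbb{C})$ is the homogeneous Sobolev space of complex-valued locally integrable functions on the plane whose distributional first derivatives are in $L^p$ of the plane. Integrals are with respect to Lebesgue measure on $\mathbb{C}$. The function $L:\mathbb{C}\times\mathbb{C}\to\mathbb{R}$ is $L(z,w)=|z|^2-|w|^2$ if $|z|+|w|\le 1$, and $L(z,w)=2|z|-1$ if $|z|+|w|>1$. For $p\in(1,\infty)$, let $p^*=\max(p,p')$ where $\frac1p+\frac1{p'}=1$, and define $\Phi_p:\mathbb{C}\times\mathbb{C}\to\mathbb{R}$ by $$\Phi_p(z,w)=\alpha_p\,\big((p^*-1)|z|-|w|\big)\,(|z|+|w|)^{p-1},\qquad \alpha_p=p\left(1-\frac1{p^*}\right)^{p-1}.$$ A stretch function is a function $f:\mathbb{C}\to\mathbb{C}$ of the form $f(re^{i\theta})=g(r)e^{i\theta}$,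 where $g$ is a nonnegative locally Lipschitz function on $(0,\infty)$ with $g(0):=g(0+)=0$ and $\lim_{r\to\infty}g(r)=0$. $\mathcal{S}$ denotes the set of all stretch functions. *)

theory Defs
  imports "HOL-Analysis.Analysis"
begin

primrec Ck :: "nat \<Rightarrow> (complex \<Rightarrow> complex) \<Rightarrow> bool" where
  "Ck 0 \<phi> \<longleftrightarrow> continuous_on UNIV \<phi>"
| "Ck (Suc k) \<phi> \<longleftrightarrow> \<phi> differentiable_on UNIV
      \<and> Ck k (\<lambda>z. frechet_derivative \<phi> (at z) 1)
      \<and> Ck k (\<lambda>z. frechet_derivative \<phi> (at z) \<i>)"

definition test_functions :: "(complex \<Rightarrow> complex) set" where
  "test_functions = {\<phi>. (\<forall>k. Ck k \<phi>) \<and> compact (closure {z. \<phi> z \<noteq> 0})}"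

definition locally_integrable :: "(complex \<Rightarrow> complex) \<Rightarrow> bool" where
  "locally_integrable f \<longleftrightarrow> (\<forall>K. compact K \<longrightarrow> set_integrable lebesgue K f)"

text \<open>\<open>u\<close> represents the distributional directional derivative of \<open>f\<close> in direction \<open>e\<close>; the
  direction is \<open>1\<close> for the \<open>x\<close>-derivative and \<open>\<i>\<close> for the \<open>y\<close>-derivative. Such a \<open>u\<close> is determined
  only up to a Lebesgue null set, hence a relation rather than a function.\<close>

definition has_weak_partial ::
    "(complex \<Rightarrow> complex) \<Rightarrow> complex \<Rightarrow> (complex \<Rightarrow> complex) \<Rightarrow> bool" where
  "has_weak_partial f e u \<longleftrightarrow> locally_integrable f \<and> locally_integrable u \<and>
     (\<forall>\<phi>\<in>test_functions.
        (LINT z|lebesgue. f z * frechet_derivative \<phi> (at z) e) = - (LINT z|lebesgue. u z * \<phi> z))"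

definition has_weak_d :: "(complex \<Rightarrow> complex) \<Rightarrow> (complex \<Rightarrow> complex) \<Rightarrow> bool" where
  "has_weak_d f u \<longleftrightarrow> (\<exists>fx fy. has_weak_partial f 1 fx \<and> has_weak_partial f \<i> fy \<and>
     u = (\<lambda>z. (fx z - \<i> * fy z) / 2))"

definition has_weak_dbar :: "(complex \<Rightarrow> complex) \<Rightarrow> (complex \<Rightarrow> complex) \<Rightarrow> bool" where
  "has_weak_dbar f u \<longleftrightarrow> (\<exists>fx fy. has_weak_partial f 1 fx \<and> has_weak_partial f \<i> fy \<and>
     u = (\<lambda>z. (fx z + \<i> * fy z) / 2))"

definition Lp :: "real \<Rightarrow> (complex \<Rightarrow> complex) set" where
  "Lp p = {u \<in> borel_measurable lebesgue. integrable lebesgue (\<lambda>z. norm (u z) powr p)}"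

definition hom_sobolev :: "real \<Rightarrow> (complex \<Rightarrow> complex) set" where
  "hom_sobolev p = {f. locally_integrable f \<and>
     (\<exists>fx\<in>Lp p. has_weak_partial f 1 fx) \<and> (\<exists>fy\<in>Lp p. has_weak_partial f \<i> fy)}"

definition L_fun :: "complex \<Rightarrow> complex \<Rightarrow> real" where
  "L_fun z w = (if norm z + norm w \<le> 1 then (norm z)\<^sup>2 - (norm w)\<^sup>2 else 2 * norm z - 1)"

definition pstar :: "real \<Rightarrow> real" where
  "pstar p = max p (p / (p - 1))"

definition alpha :: "real \<Rightarrow> real" where
  "alpha p = p * (1 - 1 / pstar p) powr (p - 1)"

definition Phi :: "real \<Rightarrow> complex \<Rightarrow> complex \<Rightarrow> real" where
  "Phi p z w = alpha p * ((pstar p - 1) * norm z - norm w) * (norm z + norm w) powr (p - 1)"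

text \<open>Recall \<open>rcis r \<theta> = r * e\<^sup>i\<^sup>\<theta>\<close>.\<close>

definition stretch_functions :: "(complex \<Rightarrow> complex) set" where
  "stretch_functions = {f. \<exists>g :: real \<Rightarrow> real.
      (\<forall>r>0. 0 \<le> g r) \<and>
      (\<forall>r>0. \<exists>\<epsilon>>0. \<exists>C. C-lipschitz_on (ball r \<epsilon> \<inter> {0<..}) g) \<and>
      g 0 = 0 \<and> (g \<longlongrightarrow> 0) (at_right 0) \<and> (g \<longlongrightarrow> 0) at_top \<and>
      (\<forall>r\<ge>0. \<forall>\<theta>. f (rcis r \<theta>) = rcis (g r) \<theta>)}"

end

theory Submission
  imports Defs
begin

text \<open>
  Write a stretch function as \<open>f (r e\<^sup>i\<^sup>\<theta>) = g r e\<^sup>i\<^sup>\<theta>\<close> and put \<open>t = g' r\<close>, \<open>s = g r / r\<close>. Wherever \<open>g\<close> is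
  differentiable, the complex derivatives have moduli \<open>\<bar>t + s\<bar> / 2\<close> and \<open>\<bar>t - s\<bar> / 2\<close>, so both
  integrands are functions of \<open>(s, t)\<close> alone. The two inequalities then come from one principle.
  For a \<open>C\<^sup>1\<close> function \<open>k\<close> put \<open>H r = r\<^sup>2 * k (g r / r)\<close>. Then
  \<open>H' r = r * (2 * k s - s * k' s + k' s * t)\<close>, which is affine in \<open>t\<close>; integrating in polar coordinates
  over \<open>a \<le> \<bar>z\<bar> \<le> b\<close> gives exactly \<open>2 * pi * (H b - H a)\<close>. The expression in parentheses is
  therefore a null Lagrangian on stretch functions, and it suffices to find a \<open>k \<ge> 0\<close> for which it
  bounds the integrand from below pointwise: the term \<open>H b\<close> is nonnegative, and \<open>H a\<close> cannot stay
  away from \<open>0\<close> as \<open>a\<close> tends to \<open>0\<close>, because \<open>H \<bar>z\<bar> / \<bar>z\<bar>\<^sup>2 = k s\<close> is integrable over the plane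
  whereas \<open>1 / \<bar>z\<bar>\<^sup>2\<close> is not integrable at the origin (\<open>null_lagrangian_integral_nonneg\<close>).

  The choice of \<open>k\<close> is dictated by tangency to the integrand as a function of \<open>t\<close>. For \<open>L\<close> it is the
  Huber function, \<open>s\<^sup>2 / 2\<close> up to \<open>s = 1\<close> and \<open>s - 1 / 2\<close> afterwards (\<open>L_fun_tangent\<close>). For \<open>\<Phi>\<^sub>p\<close> it is
  a multiple of \<open>s\<^sup>p\<close>, and homogeneity reduces the pointwise bound to an inequality in the single
  variable \<open>t / s\<close> (\<open>Phi_tangent\<close>).

  The analytic part identifies an arbitrary weak derivative with the pointwise one. A Lipschitz
  function of one real variable is differentiable almost everywhere (\<open>AE_differentiable_lipschitz\<close>,
  by two nested Vitali coverings), so \<open>f\<close> is differentiable at almost every point of the plane.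
  On compact subsets of the punctured plane \<open>f\<close> is Lipschitz, hence difference quotients are bounded
  and dominated convergence moves the derivative from the test function to \<open>f\<close>. Weak derivatives
  are unique (\<open>AE_zero_on_box\<close>), since indicators of boxes are limits of smooth bumps; the origin is
  negligible, and test functions supported away from it suffice.
\<close>

section \<open>Almost everywhere differentiability of Lipschitz functions\<close>

text \<open>The Vitali covering theorem in one dimension, where closed balls are closed intervals. Restricting
  the admissible intervals to those inside \<open>U\<close> costs nothing, as \<open>U\<close> is a neighbourhood of each of
  its points.\<close>

lemma Vitali_closed_intervals:
  fixes E U :: "real set"
  assumes "open U" "E \<subseteq> U"
    and fine: "\<And>x d. x \<in> E \<Longrightarrow> 0 < d \<Longrightarrow> \<exists>c e. c < e \<and> x \<in> {c..e} \<and> e - c < d \<and> P c e"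
  obtains C where "countable C" "\<And>c e. (c, e) \<in> C \<Longrightarrow> c < e \<and> {c..e} \<subseteq> U \<and> P c e"
    "disjoint_family_on (\<lambda>(c, e). {c..e}) C" "negligible (E - (\<Union>(c, e)\<in>C. {c..e}))"
proof -
  define K where "K = {(c, e). c < e \<and> {c..e} \<subseteq> U \<and> P c e}"
  define a where "a = (\<lambda>(c::real, e::real). (c + e) / 2)"
  define r where "r = (\<lambda>(c::real, e::real). (e - c) / 2)"
  have cball_eq: "cball (a i) (r i) = (\<lambda>(c, e). {c..e}) i" for i
    by (cases i) (auto simp: a_def r_def cball_eq_atLeastAtMost field_simps)
  have rpos: "0 < r i" if "i \<in> K" for i
    using that by (auto simp: K_def r_def)
  have fineK: "\<exists>i. i \<in> K \<and> x \<in> cball (a i) (r i) \<and> r i < d" if x: "x \<in> E" and d: "0 < d" for x d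
  proof -
    obtain \<delta> where \<delta>: "\<delta> > 0" "ball x \<delta> \<subseteq> U"
      using assms(1,2) x unfolding open_contains_ball by blast
    obtain c e where ce: "c < e" "x \<in> {c..e}" "e - c < min \<delta> d" "P c e"
      using fine[OF x, of "min \<delta> d"] \<delta> d by (metis min_less_iff_conj)
    have "{c..e} \<subseteq> ball x \<delta>" using ce by (auto simp: dist_real_def)
    then have "(c, e) \<in> K" using ce \<delta> by (auto simp: K_def)
    moreover have "r (c, e) < d" using ce by (auto simp: r_def)
    ultimately show ?thesis using ce(2) cball_eq[of "(c, e)"] by (intro exI[of _ "(c, e)"]) auto
  qed
  obtain C where C: "countable C" "C \<subseteq> K"
     "pairwise (\<lambda>i j. disjnt (cball (a i) (r i)) (cball (a j) (r j))) C"
     "negligible (E - (\<Union>i \<in> C. cball (a i) (r i)))"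
    by (rule Vitali_covering_theorem_cballs[OF rpos fineK])
  show thesis
  proof (rule that[OF C(1)])
    show "c < e \<and> {c..e} \<subseteq> U \<and> P c e" if "(c, e) \<in> C" for c e
      using that C(2) by (auto simp: K_def)
    show "disjoint_family_on (\<lambda>(c, e). {c..e}) C"
      using C(3) unfolding cball_eq pairwise_def disjoint_family_on_def disjnt_def by auto
    show "negligible (E - (\<Union>(c, e)\<in>C. {c..e}))"
      using C(4) unfolding cball_eq .
  qed
qed

lemma emeasure_disjoint_intervals_compare:
  fixes \<mu> \<nu> :: "real measure"
  assumes "sets \<mu> = sets borel" "sets \<nu> = sets borel" "countable C"
    and disj: "disjoint_family_on (\<lambda>(c, e). {c..e}) C"
    and le: "\<And>c e. (c, e) \<in> C \<Longrightarrow> k * emeasure \<mu> {c..e} \<le> l * emeasure \<nu> {c..e}"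
  shows "k * emeasure \<mu> (\<Union>(c, e)\<in>C. {c..e}) \<le> l * emeasure \<nu> (\<Union>(c, e)\<in>C. {c..e})"
proof -
  have eq: "emeasure M (\<Union>(c, e)\<in>C. {c..e}) = (\<integral>\<^sup>+i. emeasure M (case i of (c, e) \<Rightarrow> {c..e}) \<partial>count_space C)"
    if "sets M = sets borel" for M :: "real measure"
    using disj by (intro emeasure_UN_countable) (auto simp: that assms)
  then show ?thesis
    using assms(1,2) le by (simp add: eq) (subst (1 2) nn_integral_cmult[symmetric]; auto intro!: nn_integral_mono)
qed

text \<open>The two hypotheses on \<open>E\<close> say that near each of its points arbitrarily short intervals have slope
  at most \<open>p\<close>, and others slope at least \<open>q > p\<close>. Slopes of \<open>\<Phi>\<close> compare Lebesgue measure with the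
  measure \<open>\<mu>\<close> of \<open>\<Phi>\<close>-images. A first Vitali covering inside an open set barely larger than
  \<open>E\<close> uses intervals of small slope, a second one inside the interiors of the first uses
  intervals of large slope. Both cover almost all of \<open>E\<close>, so with \<open>m\<close> the outer measure of \<open>E\<close> the
  chain of inclusions yields \<open>q * m \<le> p * (m + \<epsilon>)\<close>, which forces \<open>m = 0\<close>.\<close>

lemma negligible_crossing_slopes:
  fixes \<Phi> :: "real \<Rightarrow> real"
  assumes mono: "\<And>x y. x < y \<Longrightarrow> \<Phi> x < \<Phi> y" and cont: "continuous_on UNIV \<Phi>" and surj: "surj \<Phi>"
    and pq: "0 < p" "p < q"
    and lo: "\<And>x d. x \<in> E \<Longrightarrow> 0 < d \<Longrightarrow>
        \<exists>c e. c < e \<and> x \<in> {c..e} \<and> e - c < d \<and> \<Phi> e - \<Phi> c \<le> p * (e - c)"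
    and hi: "\<And>x d. x \<in> E \<Longrightarrow> 0 < d \<Longrightarrow>
        \<exists>c e. c < e \<and> x \<in> {c..e} \<and> e - c < d \<and> q * (e - c) \<le> \<Phi> e - \<Phi> c"
    and bdd: "bounded E"
  shows "negligible E"
proof -
  have inj: "inj \<Phi>" using mono by (metis injI linorder_neqE order_less_irrefl)
  define \<Psi> where "\<Psi> = inv \<Phi>"
  have \<Psi>\<Phi>: "\<Psi> (\<Phi> x) = x" for x using inj by (simp add: \<Psi>_def)
  have \<Phi>\<Psi>: "\<Phi> (\<Psi> x) = x" for x using surj by (simp add: \<Psi>_def surj_f_inv_f)
  have smono: "strict_mono \<Phi>" using mono by (auto intro: strict_monoI)
  have \<Psi>_le: "a \<le> \<Psi> y \<longleftrightarrow> \<Phi> a \<le> y" "\<Psi> y \<le> a \<longleftrightarrow> y \<le> \<Phi> a" for a y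
    using strict_mono_less_eq[OF smono] \<Phi>\<Psi> by metis+
  have "mono \<Psi>" by (intro monoI) (simp add: \<Psi>_le \<Phi>\<Psi>)
  then have [measurable]: "\<Psi> \<in> borel_measurable borel" by (rule borel_measurable_mono)
  \<comment> \<open>The measure of \<open>\<Phi>\<close>-images, written as a push-forward along the inverse.\<close>
  define \<mu> where "\<mu> = distr lborel borel \<Psi>"
  have \<mu>: "emeasure \<mu> {c..e} = ennreal (\<Phi> e - \<Phi> c)" if "c < e" for c e
  proof -
    have "\<Psi> -` {c..e} = {\<Phi> c..\<Phi> e}" by (auto simp: \<Psi>_le)
    then show ?thesis using mono[OF that] by (simp add: \<mu>_def emeasure_distr)
  qed
  have sets_\<mu>: "sets \<mu> = sets borel" by (simp add: \<mu>_def)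
  define m where "m = outer_measure_of lborel E"
  obtain E' where E': "E' \<in> sets borel" "E \<subseteq> E'" "m = emeasure lborel E'"
    using outer_measure_of_attain[of E lborel] by (auto simp: m_def)
  obtain B where B: "E \<subseteq> ball 0 B" using bdd bounded_subset_ballD by blast
  have m_fin: "m < \<infinity>"
  proof -
    have "m \<le> outer_measure_of lborel (ball 0 B :: real set)" unfolding m_def by (rule outer_measure_of_mono[OF B])
    also have "\<dots> < \<infinity>" using emeasure_bounded_finite[of "ball 0 B :: real set"] by simp
    finally show ?thesis .
  qed
  have key: "ennreal q * m \<le> ennreal p * m + ennreal p * ennreal \<epsilon>" if "\<epsilon> > 0" for \<epsilon> :: real
  proof -
    obtain U where U: "E' \<subseteq> U" "open U" "emeasure lborel (U - E') < ennreal \<epsilon>"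
      using outer_regular_lborel[OF E'(1) \<open>\<epsilon> > 0\<close>] by metis
    have [measurable]: "U \<in> sets borel" "E' \<in> sets borel" using U E' by auto
    have "emeasure lborel U = emeasure lborel (E' \<union> (U - E'))" using U(1) by (intro arg_cong[where f="emeasure lborel"]) auto
    also have "\<dots> \<le> emeasure lborel E' + emeasure lborel (U - E')" by (rule emeasure_subadditive) auto
    also have "\<dots> \<le> m + ennreal \<epsilon>" using U(3) E'(3) by (intro add_mono) auto
    finally have U_le: "emeasure lborel U \<le> m + ennreal \<epsilon>" .
    obtain C1 where C1: "countable C1"
      "\<And>c e. (c, e) \<in> C1 \<Longrightarrow> c < e \<and> {c..e} \<subseteq> U \<and> \<Phi> e - \<Phi> c \<le> p * (e - c)"
      "disjoint_family_on (\<lambda>(c, e). {c..e}) C1" "negligible (E - (\<Union>(c, e)\<in>C1. {c..e}))"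
      using Vitali_closed_intervals[of U E "\<lambda>c e. \<Phi> e - \<Phi> c \<le> p * (e - c)", OF U(2) _ lo]
        U(1) E'(2) by blast
    define W1 where "W1 = (\<Union>(c, e)\<in>C1. {c..e})"
    \<comment> \<open>Only the countably many endpoints separate the open set \<open>V\<close> from the cover; the second cover is taken inside it.\<close>
    define V where "V = (\<Union>(c, e)\<in>C1. {c<..<e})"
    have meas: "(\<Union>(c, e)\<in>C. {c..e}) \<in> sets borel" if "countable C" for C :: "(real \<times> real) set"
      using that by (intro sets.countable_UN') auto
    have "open V" unfolding V_def by auto
    obtain C2 where C2: "countable C2"
      "\<And>c e. (c, e) \<in> C2 \<Longrightarrow> c < e \<and> {c..e} \<subseteq> V \<and> q * (e - c) \<le> \<Phi> e - \<Phi> c"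
      "disjoint_family_on (\<lambda>(c, e). {c..e}) C2" "negligible (E \<inter> V - (\<Union>(c, e)\<in>C2. {c..e}))"
      using Vitali_closed_intervals[of V "E \<inter> V" "\<lambda>c e. q * (e - c) \<le> \<Phi> e - \<Phi> c", OF \<open>open V\<close> _ hi]
      by blast
    define W2 where "W2 = (\<Union>(c, e)\<in>C2. {c..e})"
    have [measurable]: "W1 \<in> sets borel" "W2 \<in> sets borel"
      using meas C1(1) C2(1) by (auto simp: W1_def W2_def)
    have "W2 \<subseteq> V" using C2(2) by (fastforce simp: W2_def)
    moreover have "V \<subseteq> W1" unfolding V_def W1_def by (intro UN_mono) auto
    ultimately have W21: "W2 \<subseteq> W1" by auto
    have W1U: "W1 \<subseteq> U" using C1(2) by (fastforce simp: W1_def)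
    define Z where "Z = (E - W1) \<union> (E \<inter> V - W2) \<union> (fst ` C1 \<union> snd ` C1)"
    have "negligible (fst ` C1 \<union> snd ` C1)"
      using C1(1) by (auto simp: negligible_iff_null_sets intro!: null_sets_completionI countable_imp_null_set_lborel)
    then have "negligible Z"
      using C1(1,4) C2(4)
      unfolding Z_def W1_def W2_def by (intro negligible_Un[OF negligible_Un])
    then have "Z \<in> null_sets lebesgue" by (simp add: negligible_iff_null_sets)
    then obtain Z' where Z': "Z' \<in> null_sets lborel" "Z \<subseteq> Z'"
      using null_sets_completion_iff2[of Z lborel] by blast
    have "E \<subseteq> W2 \<union> Z'"
    proof
      fix x assume "x \<in> E"
      have "x \<in> V \<or> x \<in> fst ` C1 \<union> snd ` C1" if xW: "x \<in> W1"
      proof -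
        obtain c e where ce: "(c, e) \<in> C1" "c \<le> x" "x \<le> e" using xW by (auto simp: W1_def)
        show ?thesis
        proof (cases "x = c \<or> x = e")
          case True then show ?thesis using ce by force
        next
          case False then have "x \<in> V" using ce by (force simp: V_def)
          then show ?thesis ..
        qed
      qed
      then show "x \<in> W2 \<union> Z'" using \<open>x \<in> E\<close> Z'(2) unfolding Z_def by blast
    qed
    then have "m \<le> outer_measure_of lborel (W2 \<union> Z')" unfolding m_def by (rule outer_measure_of_mono)
    also have "\<dots> = emeasure lborel W2"
      using Z'(1) by (subst outer_measure_of_eq) (auto intro!: emeasure_Un_null_set)
    finally have "ennreal q * m \<le> ennreal q * emeasure lborel W2" by (rule mult_left_mono) simp
    also have "\<dots> \<le> 1 * emeasure \<mu> W2" unfolding W2_def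
    proof (intro emeasure_disjoint_intervals_compare)
      fix c e assume "(c, e) \<in> C2"
      then have ce: "c < e" "q * (e - c) \<le> \<Phi> e - \<Phi> c" using C2(2) by auto
      then have "ennreal q * emeasure lborel {c..e} = ennreal (q * (e - c))"
        using pq by (simp add: ennreal_mult)
      then show "ennreal q * emeasure lborel {c..e} \<le> 1 * emeasure \<mu> {c..e}"
        using ce by (simp add: \<mu> ennreal_leI)
    qed (use C2 sets_\<mu> in auto)
    also have "\<dots> \<le> 1 * emeasure \<mu> W1" using W21 by (auto intro!: emeasure_mono simp: sets_\<mu>)
    also have "\<dots> \<le> ennreal p * emeasure lborel W1" unfolding W1_def
    proof (intro emeasure_disjoint_intervals_compare)
      fix c e assume "(c, e) \<in> C1"
      then have ce: "c < e" "\<Phi> e - \<Phi> c \<le> p * (e - c)" using C1(2) by auto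
      then have "ennreal p * emeasure lborel {c..e} = ennreal (p * (e - c))"
        using pq by (simp add: ennreal_mult)
      then show "1 * emeasure \<mu> {c..e} \<le> ennreal p * emeasure lborel {c..e}"
        using ce by (simp add: \<mu> ennreal_leI)
    qed (use C1 sets_\<mu> in auto)
    also have "\<dots> \<le> ennreal p * (m + ennreal \<epsilon>)"
      using W1U U_le by (intro mult_left_mono order_trans[OF emeasure_mono U_le]) auto
    finally show ?thesis by (simp add: distrib_left)
  qed
  obtain m' where m': "m = ennreal m'" "0 \<le> m'" using m_fin by (cases m) auto
  have "q * m' \<le> p * m' + e" if "e > 0" for e
  proof -
    have "ennreal (q * m') = ennreal q * m" using m' pq by (simp add: ennreal_mult)
    also have "\<dots> \<le> ennreal p * m + ennreal p * ennreal (e / p)" using that pq by (intro key) auto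
    also have "\<dots> = ennreal (p * m') + ennreal (p * (e / p))"
      using m' pq that by (subst (1 2) ennreal_mult) auto
    also have "\<dots> = ennreal (p * m' + e)" using m' pq that by (subst ennreal_plus[symmetric]) auto
    finally show ?thesis using pq m' that by (subst (asm) ennreal_le_iff) (auto intro!: add_nonneg_nonneg)
  qed
  then have "q * m' \<le> p * m'" by (rule field_le_epsilon)
  then have "m' = 0" using pq m' by (smt (verit) mult_le_cancel_right)
  then have "E' \<in> null_sets lborel" using E' m' by (auto simp: null_sets_def)
  then show ?thesis using E'(2) by (meson negligible_iff_null_sets negligible_subset null_sets_completionI)
qed

text \<open>If the difference quotient at \<open>x\<close> does not converge, two rationals separate its lower and upper
  limits, so \<open>x\<close> lies in one of countably many sets with crossing slopes. The lower slope bound \<open>1\<close>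
  makes \<open>\<Phi>\<close> a homeomorphism and keeps these rationals positive.\<close>

lemma AE_differentiable_bilipschitz:
  fixes \<Phi> :: "real \<Rightarrow> real"
  assumes slopes: "\<And>x y. x < y \<Longrightarrow> y - x \<le> \<Phi> y - \<Phi> x \<and> \<Phi> y - \<Phi> x \<le> K * (y - x)"
  shows "AE x in lborel. \<Phi> differentiable at x"
proof -
  have mono: "\<Phi> x < \<Phi> y" if "x < y" for x y using slopes[OF that] that by linarith
  have "K-lipschitz_on UNIV \<Phi>"
  proof (rule lipschitz_onI)
    show "dist (\<Phi> x) (\<Phi> y) \<le> K * dist x y" for x y
      using slopes[of x y] slopes[of y x] by (cases x y rule: linorder_cases) (auto simp: dist_real_def)
    show "0 \<le> K" using slopes[of 0 1] by auto
  qed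
  then have cont: "continuous_on UNIV \<Phi>" by (rule lipschitz_on_continuous_on)
  have surj: "surj \<Phi>"
  proof -
    have "\<exists>x. \<Phi> x = y" for y
    proof -
      define M where "M = \<bar>y - \<Phi> 0\<bar> + 1"
      have "\<Phi> (-M) \<le> y" "y \<le> \<Phi> M"
        using slopes[of "-M" 0] slopes[of 0 M] unfolding M_def by linarith+
      moreover have "continuous_on {-M..M} \<Phi>" using cont continuous_on_subset by blast
      ultimately show ?thesis using IVT'[of \<Phi> "-M" y M] by (auto simp: M_def)
    qed
    then show ?thesis by (metis surjI)
  qed
  define Q where "Q x y = (\<Phi> y - \<Phi> x) / (y - x)" for x y
  have Q: "1 \<le> Q x y" "Q x y \<le> K" if "y \<noteq> x" for x y
    using slopes[of x y] slopes[of y x] that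
    by (cases x y rule: linorder_cases; simp add: Q_def field_simps)+
  \<comment> \<open>The bound \<open>n\<close> makes the exceptional sets bounded, hence of finite outer measure.\<close>
  define E where "E p q n = {x \<in> ball 0 (real n). (\<exists>\<^sub>F y in at x. Q x y < p) \<and> (\<exists>\<^sub>F y in at x. q < Q x y)}"
    for p q :: real and n :: nat
  have freq: "\<exists>c e. c < e \<and> x \<in> {c..e} \<and> e - c < d \<and> R ((\<Phi> e - \<Phi> c) / (e - c))"
    if "\<exists>\<^sub>F y in at x. R (Q x y)" "0 < d" for x d and R :: "real \<Rightarrow> bool"
  proof -
    have "\<forall>\<^sub>F y in at x. dist y x < d \<and> y \<noteq> x"
      using that(2) by (auto simp: eventually_at)
    then have "\<exists>\<^sub>F y in at x. (dist y x < d \<and> y \<noteq> x) \<and> R (Q x y)"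
      by (rule frequently_eventually_conj[OF that(1)])
    then obtain y where y: "R (Q x y)" "dist y x < d" "y \<noteq> x" by (auto dest: frequently_ex)
    have "Q x y = (\<Phi> (max x y) - \<Phi> (min x y)) / (max x y - min x y)"
      using y(3) by (auto simp: Q_def max_def min_def field_simps)
    then show ?thesis using y
      by (intro exI[of _ "min x y"] exI[of _ "max x y"]) (auto simp: dist_real_def)
  qed
  have "negligible (E p q n)" if pq: "0 < p" "p < q" for p q n
  proof (rule negligible_crossing_slopes[OF mono cont surj pq])
    fix x d :: real assume x: "x \<in> E p q n" and d: "0 < d"
    obtain c e where "c < e" "x \<in> {c..e}" "e - c < d" "(\<Phi> e - \<Phi> c) / (e - c) < p"
      using freq[of "\<lambda>s. s < p" x d] x d unfolding E_def by blast
    then show "\<exists>c e. c < e \<and> x \<in> {c..e} \<and> e - c < d \<and> \<Phi> e - \<Phi> c \<le> p * (e - c)"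
      by (intro exI[of _ c] exI[of _ e]) (simp add: pos_divide_less_eq)
    obtain c e where "c < e" "x \<in> {c..e}" "e - c < d" "q < (\<Phi> e - \<Phi> c) / (e - c)"
      using freq[of "\<lambda>s. q < s" x d] x d unfolding E_def by blast
    then show "\<exists>c e. c < e \<and> x \<in> {c..e} \<and> e - c < d \<and> q * (e - c) \<le> \<Phi> e - \<Phi> c"
      by (intro exI[of _ c] exI[of _ e]) (simp add: pos_less_divide_eq)
  next
    show "bounded (E p q n)" by (rule bounded_subset[OF bounded_ball[of 0 "real n"]]) (auto simp: E_def)
  qed
  then have null: "AE x in lebesgue. x \<notin> E p q n" if "0 < p" "p < q" for p q n
    using that by (auto simp: negligible_iff_null_sets intro!: AE_not_in)
  have "AE x in lebesgue. \<forall>n. \<forall>p\<in>\<rat>. \<forall>q\<in>\<rat>. 0 < p \<and> p < q \<longrightarrow> x \<notin> E p q n"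
    unfolding AE_all_countable by (intro allI AE_ball_countable' AE_impI countable_rat) (use null in auto)
  then have "AE x in lebesgue. \<Phi> differentiable at x"
  proof eventually_elim
    case (elim x)
    have nb: "at x \<noteq> bot" by simp
    have evK: "\<forall>\<^sub>F y in at x. 1 \<le> Q x y \<and> Q x y \<le> K"
      using Q by (auto simp: eventually_at_filter)
    have ge1: "1 \<le> Liminf (at x) (\<lambda>y. ereal (Q x y))"
      by (rule Liminf_bounded) (use evK in \<open>auto elim!: eventually_mono\<close>)
    have leK: "Limsup (at x) (\<lambda>y. ereal (Q x y)) \<le> ereal K"
      by (rule Limsup_bounded) (use evK in \<open>auto elim!: eventually_mono\<close>)
    have "Limsup (at x) (\<lambda>y. ereal (Q x y)) \<le> Liminf (at x) (\<lambda>y. ereal (Q x y))"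
    proof (rule ccontr)
      assume "\<not> ?thesis"
      then have "Liminf (at x) (\<lambda>y. ereal (Q x y)) < Limsup (at x) (\<lambda>y. ereal (Q x y))" by simp
      then obtain p0 q0 where p0: "Liminf (at x) (\<lambda>y. ereal (Q x y)) < ereal (real_of_rat p0)"
        and q0: "ereal (real_of_rat p0) < ereal (real_of_rat q0)"
          "ereal (real_of_rat q0) < Limsup (at x) (\<lambda>y. ereal (Q x y))"
        by (meson ereal_dense3)
      have "1 < ereal (real_of_rat p0)" using ge1 p0 by order
      then have p0pos: "0 < real_of_rat p0" by (simp add: one_ereal_def)
      have "\<exists>\<^sub>F y in at x. Q x y < real_of_rat p0"
      proof (rule ccontr)
        assume "\<not> ?thesis"
        then have "\<forall>\<^sub>F y in at x. ereal (real_of_rat p0) \<le> ereal (Q x y)"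
          by (simp add: not_frequently not_less)
        then show False using Liminf_bounded[of "ereal (real_of_rat p0)" "\<lambda>y. ereal (Q x y)" "at x"] p0 by auto
      qed
      moreover have "\<exists>\<^sub>F y in at x. real_of_rat q0 < Q x y"
      proof (rule ccontr)
        assume "\<not> ?thesis"
        then have "\<forall>\<^sub>F y in at x. ereal (Q x y) \<le> ereal (real_of_rat q0)"
          by (simp add: not_frequently not_less)
        then show False using Limsup_bounded[of "\<lambda>y. ereal (Q x y)" "ereal (real_of_rat q0)" "at x"] q0 by auto
      qed
      moreover obtain n :: nat where "\<bar>x\<bar> < real n" using reals_Archimedean2 by blast
      ultimately have "x \<in> E (real_of_rat p0) (real_of_rat q0) n"
        by (auto simp: E_def)
      then show False using elim p0pos q0(1) by (auto simp: Rats_def)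
    qed
    then have eq: "Limsup (at x) (\<lambda>y. ereal (Q x y)) = Liminf (at x) (\<lambda>y. ereal (Q x y))"
      using Liminf_le_Limsup[OF nb, of "\<lambda>y. ereal (Q x y)"] by order
    obtain t where t: "Liminf (at x) (\<lambda>y. ereal (Q x y)) = ereal t"
      using ge1 leK eq by (cases "Liminf (at x) (\<lambda>y. ereal (Q x y))") auto
    have "((\<lambda>y. ereal (Q x y)) \<longlongrightarrow> ereal t) (at x)"
      using eq t by (subst tendsto_iff_Liminf_eq_Limsup) auto
    then have "((\<lambda>y. Q x y) \<longlongrightarrow> t) (at x)" by simp
    then have "(\<Phi> has_real_derivative t) (at x)"
      by (simp add: has_field_derivative_iff Q_def)
    then show ?case using real_differentiable_def by blast
  qed
  then show ?thesis by (simp add: AE_completion_iff)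
qed

text \<open>Adding a steep linear function turns a Lipschitz function into a bilipschitz increasing one without
  affecting differentiability.\<close>

lemma AE_differentiable_lipschitz:
  fixes g :: "real \<Rightarrow> real"
  assumes "C-lipschitz_on UNIV g"
  shows "AE x in lborel. g differentiable at x"
proof -
  define \<Phi> where "\<Phi> x = g x + (C + 1) * x" for x
  have "AE x in lborel. \<Phi> differentiable at x"
  proof (rule AE_differentiable_bilipschitz[where K="2 * C + 1"])
    fix x y :: real assume "x < y"
    then have "\<bar>g y - g x\<bar> \<le> C * (y - x)"
      using lipschitz_onD[OF assms, of y x] by (auto simp: dist_real_def)
    then show "y - x \<le> \<Phi> y - \<Phi> x \<and> \<Phi> y - \<Phi> x \<le> (2 * C + 1) * (y - x)"
      by (auto simp: \<Phi>_def algebra_simps abs_le_iff)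
  qed
  then show ?thesis
  proof eventually_elim
    case (elim x)
    have "g = (\<lambda>x. \<Phi> x - (C + 1) * x)" by (auto simp: \<Phi>_def)
    then show ?case using elim by (auto intro!: derivative_intros)
  qed
qed

section \<open>Radial functions in polar coordinates\<close>

text \<open>It suffices to compare discs: both sides give \<open>pi * R\<^sup>2\<close> to the half-line up to \<open>R \<ge> 0\<close>.\<close>

lemma distr_norm_lborel_complex:
  "distr lborel borel (norm :: complex \<Rightarrow> real) =
     density lborel (\<lambda>r. ennreal (2 * pi * r) * indicator {0<..} r)" (is "?M = ?N")
proof (rule measure_eqI_generator_eq[where E="range atMost" and \<Omega>=UNIV and A="\<lambda>n. {..real n}"])
  show "Int_stable (range (atMost :: real \<Rightarrow> _))"
    by (auto simp: Int_stable_def min_def[symmetric] Int_atMost)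
  show "sets ?M = sigma_sets UNIV (range atMost)" "sets ?N = sigma_sets UNIV (range atMost)"
    by (simp_all add: borel_eq_atMost)
  have M: "emeasure ?M {..R} = ennreal (pi * (max 0 R)\<^sup>2)" for R :: real
  proof -
    have "(norm :: complex \<Rightarrow> real) -` {..R} = cball 0 R" by auto
    then have *: "emeasure ?M {..R} = emeasure lborel (cball (0::complex) R)"
      by (simp add: emeasure_distr)
    show ?thesis
    proof (cases "R \<ge> 0")
      case True
      then show ?thesis unfolding * by (simp add: emeasure_cball unit_ball_vol_2)
    next
      case False
      then have "cball (0::complex) R = {}" by simp
      then show ?thesis unfolding * using False by simp
    qed
  qed
  have N: "emeasure ?N {..R} = ennreal (pi * (max 0 R)\<^sup>2)" for R :: real
  proof -
    define S where "S = max 0 R"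
    have "emeasure ?N {..R} = (\<integral>\<^sup>+r. ennreal (2 * pi * r) * indicator {0..S} r \<partial>lborel)"
      by (auto simp: emeasure_density S_def intro!: nn_integral_cong split: split_indicator)
    also have "\<dots> = ennreal (pi * S\<^sup>2 - pi * 0\<^sup>2)"
      by (rule nn_integral_FTC_Icc) (auto simp: S_def intro!: derivative_eq_intros)
    finally show ?thesis by (simp add: S_def)
  qed
  show "emeasure ?M X = emeasure ?N X" if "X \<in> range atMost" for X
    using that M N by auto
  show "(\<Union>i. {..real i}) = UNIV" using real_arch_simple by auto
  show "emeasure ?M {..real n} \<noteq> \<infinity>" for n unfolding M by simp
qed auto

lemma AE_norm_complex:
  assumes "AE r in lborel. 0 < r \<longrightarrow> P r"
  shows "AE z::complex in lborel. z \<noteq> 0 \<longrightarrow> P (norm z)"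
proof -
  obtain N where N: "N \<in> null_sets lborel" "{r. \<not> (0 < r \<longrightarrow> P r)} \<subseteq> N"
    using assms by (auto elim!: AE_E simp: null_sets_def)
  have [measurable]: "N \<in> sets borel" using N by auto
  have "emeasure (distr lborel borel (norm :: complex \<Rightarrow> real)) N
      = (\<integral>\<^sup>+r. (ennreal (2 * pi * r) * indicator {0<..} r) * indicator N r \<partial>lborel)"
    unfolding distr_norm_lborel_complex by (rule emeasure_density) auto
  also have "\<dots> = 0"
    using AE_not_in[OF N(1)] by (subst nn_integral_0_iff_AE) (auto elim!: eventually_mono)
  finally have "(norm :: complex \<Rightarrow> real) -` N \<in> null_sets lborel"
    using measurable_sets[of norm borel borel N] by (auto simp: emeasure_distr null_sets_def)
  from AE_not_in[OF this] show ?thesis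
  proof eventually_elim
    case (elim z)
    then show ?case using subsetD[OF N(2), of "norm z"] by auto
  qed
qed

lemma integral_radial_complex:
  fixes k :: "real \<Rightarrow> real"
  assumes [measurable]: "k \<in> borel_measurable borel"
  shows "(\<integral>z. k (norm (z::complex)) \<partial>lborel) = (\<integral>r. (2 * pi * r) * indicator {0<..} r * k r \<partial>lborel)"
proof -
  have "(\<integral>z. k (norm (z::complex)) \<partial>lborel) = integral\<^sup>L (distr lborel borel (norm :: complex \<Rightarrow> real)) k"
    by (rule integral_distr[symmetric]) auto
  also have "\<dots> = integral\<^sup>L (density lborel (\<lambda>r. ennreal ((2 * pi * r) * indicator {0<..} r))) k"
    unfolding distr_norm_lborel_complex
    by (intro arg_cong2[where f="integral\<^sup>L"] density_cong) (auto split: split_indicator)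
  also have "\<dots> = (\<integral>r. (2 * pi * r) * indicator {0<..} r * k r \<partial>lborel)"
    by (subst integral_density) (auto split: split_indicator)
  finally show ?thesis .
qed

section \<open>Smooth bumps and the fundamental lemma of the calculus of variations\<close>

text \<open>The classical flat functions. All derivatives of \<open>exp (- 1 / x)\<close> on the positive half-line are linear
  combinations of these, which is the reason for the parameter \<open>k\<close>.\<close>

definition flat_exp :: "nat \<Rightarrow> real \<Rightarrow> real" where
  "flat_exp k x = (if 0 < x then exp (- 1 / x) / x ^ k else 0)"

lemma flat_exp_tendsto_0: "(flat_exp k \<longlongrightarrow> 0) (at 0)"
proof -
  have "((\<lambda>u::real. u ^ k / exp u) \<longlongrightarrow> 0) at_top" by (rule tendsto_power_div_exp_0)
  then have "((\<lambda>x::real. inverse x ^ k / exp (inverse x)) \<longlongrightarrow> 0) (at_right 0)"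
    by (rule filterlim_compose[OF _ filterlim_inverse_at_top_right])
  moreover have "\<forall>\<^sub>F x in at_right 0. inverse x ^ k / exp (inverse x) = flat_exp k x"
    using eventually_at_right_less[of 0]
  proof eventually_elim
    case (elim x)
    have "exp (- 1 / x) = inverse (exp (inverse x))"
      by (simp add: exp_minus inverse_eq_divide)
    then show ?case using elim by (simp add: flat_exp_def divide_inverse power_inverse)
  qed
  ultimately have "(flat_exp k \<longlongrightarrow> 0) (at_right 0)"
    by (rule Lim_transform_eventually)
  moreover have "(flat_exp k \<longlongrightarrow> 0) (at_left 0)"
    by (rule Lim_transform_eventually[OF tendsto_const]) (auto simp: flat_exp_def eventually_at_filter)
  ultimately show ?thesis by (simp add: filterlim_split_at)
qed

lemma DERIV_flat_exp:
  "(flat_exp k has_real_derivative flat_exp (k + 2) x - real k * flat_exp (k + 1) x) (at x)"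
proof (cases x "0::real" rule: linorder_cases)
  case less
  have "((\<lambda>x. 0) has_real_derivative 0) (at x)" by simp
  then have "(flat_exp k has_real_derivative 0) (at x)"
    by (rule has_field_derivative_transform_within_open[where S="{..<0}"]) (use less in \<open>auto simp: flat_exp_def\<close>)
  then show ?thesis using less by (simp add: flat_exp_def)
next
  case equal
  have "((\<lambda>h. flat_exp k h / h) \<longlongrightarrow> 0) (at 0)"
    by (rule Lim_transform_eventually[OF flat_exp_tendsto_0[of "k + 1"]])
      (auto simp: flat_exp_def eventually_at_filter)
  then show ?thesis using equal by (simp add: has_field_derivative_iff flat_exp_def)
next
  case greater
  have "((\<lambda>x. exp (- 1 / x) / x ^ k) has_real_derivative
      flat_exp (k + 2) x - real k * flat_exp (k + 1) x) (at x)"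
    using greater
    by (cases k) (auto intro!: derivative_eq_intros simp: flat_exp_def divide_simps power2_eq_square, simp_all add: algebra_simps, metis One_nat_def power_eq_if)
  then show ?thesis
    by (rule has_field_derivative_transform_within_open[where S="{0<..}"])
       (use greater in \<open>auto simp: flat_exp_def\<close>)
qed

text \<open>A set of functions closed under differentiation that contains the bumps needed below. Closure is
  proved by induction over this generation, so that no higher derivative has to be written down.\<close>

inductive_set flat_algebra :: "(real \<Rightarrow> real) set" where
  const: "(\<lambda>x. c) \<in> flat_algebra"
| flat: "(\<lambda>x. flat_exp k (a * x + b)) \<in> flat_algebra"
| add: "A \<in> flat_algebra \<Longrightarrow> B \<in> flat_algebra \<Longrightarrow> (\<lambda>x. A x + B x) \<in> flat_algebra"
| mult: "A \<in> flat_algebra \<Longrightarrow> B \<in> flat_algebra \<Longrightarrow> (\<lambda>x. A x * B x) \<in> flat_algebra"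

lemma flat_algebra_derivative:
  "A \<in> flat_algebra \<Longrightarrow> \<exists>A'\<in>flat_algebra. \<forall>x. (A has_real_derivative A' x) (at x)"
proof (induction rule: flat_algebra.induct)
  case (const c)
  then show ?case by (intro bexI[of _ "\<lambda>x. 0"]) (auto intro: flat_algebra.const)
next
  case (flat k a b)
  have "(\<lambda>x. a * (flat_exp (k + 2) (a * x + b) + (- real k) * flat_exp (k + 1) (a * x + b))) \<in> flat_algebra"
    by (intro flat_algebra.intros)
  moreover have "((\<lambda>x. flat_exp k (a * x + b)) has_real_derivative
      a * (flat_exp (k + 2) (a * x + b) + (- real k) * flat_exp (k + 1) (a * x + b))) (at x)" for x
    by (rule DERIV_chain2[OF DERIV_flat_exp, THEN DERIV_cong]) (auto intro!: derivative_eq_intros)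
  ultimately show ?case by (intro bexI allI)
next
  case (add A B)
  then obtain A' B' where "A' \<in> flat_algebra" "B' \<in> flat_algebra"
    "\<forall>x. (A has_real_derivative A' x) (at x)" "\<forall>x. (B has_real_derivative B' x) (at x)" by blast
  then show ?case
    by (intro bexI[of _ "\<lambda>x. A' x + B' x"]) (auto intro: flat_algebra.add intro!: derivative_intros)
next
  case (mult A B)
  then obtain A' B' where "A' \<in> flat_algebra" "B' \<in> flat_algebra"
    "\<forall>x. (A has_real_derivative A' x) (at x)" "\<forall>x. (B has_real_derivative B' x) (at x)" by blast
  with mult show ?case
    by (intro bexI[of _ "\<lambda>x. A' x * B x + B' x * A x"])
       (auto intro!: flat_algebra.add flat_algebra.mult DERIV_mult)
qed

text \<open>The partial derivatives of \<open>A (Re z) * B (Im z)\<close> are again of this form, so smoothness follows by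
  induction on the order.\<close>

lemma Ck_flat_product:
  assumes "A \<in> flat_algebra" "B \<in> flat_algebra"
  shows "Ck n (\<lambda>z. complex_of_real (A (Re z) * B (Im z)))"
  using assms
proof (induction n arbitrary: A B)
  have der: "\<exists>A'\<in>flat_algebra. \<exists>B'\<in>flat_algebra. \<forall>z.
      ((\<lambda>z. complex_of_real (A (Re z) * B (Im z))) has_derivative
       (\<lambda>h. complex_of_real (A' (Re z) * Re h * B (Im z) + A (Re z) * (B' (Im z) * Im h)))) (at z)"
    if AB: "A \<in> flat_algebra" "B \<in> flat_algebra" for A B
  proof -
    obtain A' B' where *: "A' \<in> flat_algebra" "B' \<in> flat_algebra"
      "\<forall>x. (A has_real_derivative A' x) (at x)" "\<forall>x. (B has_real_derivative B' x) (at x)"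
      using flat_algebra_derivative AB by metis
    have A: "((\<lambda>z. A (Re z)) has_derivative (\<lambda>h. A' (Re z) * Re h)) (at z)" for z
      using *(3) has_derivative_compose[of Re Re z UNIV A "(*) (A' (Re z))"]
      by (auto simp: has_field_derivative_def intro: bounded_linear_imp_has_derivative bounded_linear_Re)
    have B: "((\<lambda>z. B (Im z)) has_derivative (\<lambda>h. B' (Im z) * Im h)) (at z)" for z
      using *(4) has_derivative_compose[of Im Im z UNIV B "(*) (B' (Im z))"]
      by (auto simp: has_field_derivative_def intro: bounded_linear_imp_has_derivative bounded_linear_Im)
    have "((\<lambda>z. complex_of_real (A (Re z) * B (Im z))) has_derivative
       (\<lambda>h. complex_of_real (A' (Re z) * Re h * B (Im z) + A (Re z) * (B' (Im z) * Im h)))) (at z)" for z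
      by (rule has_derivative_of_real has_derivative_eq_rhs[OF has_derivative_mult[OF A B]])+ auto
    with * show ?thesis by blast
  qed
  {
    case 0
    have "(\<lambda>z. complex_of_real (A (Re z) * B (Im z))) differentiable_on UNIV"
      using der[OF 0] unfolding differentiable_on_def differentiable_def by blast
    then show ?case using differentiable_imp_continuous_on by simp
  next
    case (Suc n)
    obtain A' B' where A'B': "A' \<in> flat_algebra" "B' \<in> flat_algebra"
      and d: "\<And>z. ((\<lambda>z. complex_of_real (A (Re z) * B (Im z))) has_derivative
       (\<lambda>h. complex_of_real (A' (Re z) * Re h * B (Im z) + A (Re z) * (B' (Im z) * Im h)))) (at z)"
      using der[OF Suc.prems] by blast
    have fd: "frechet_derivative (\<lambda>z. complex_of_real (A (Re z) * B (Im z))) (at z) =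
       (\<lambda>h. complex_of_real (A' (Re z) * Re h * B (Im z) + A (Re z) * (B' (Im z) * Im h)))" for z
      by (rule frechet_derivative_at[OF d, symmetric])
    have "(\<lambda>z. complex_of_real (A (Re z) * B (Im z))) differentiable_on UNIV"
      using d unfolding differentiable_on_def differentiable_def by blast
    then show ?case
      unfolding Ck.simps fd
      using Suc.IH[OF A'B'(1) Suc.prems(2)] Suc.IH[OF Suc.prems(1) A'B'(2)] by simp
  }
qed

text \<open>Since \<open>flat_exp 0 (n * x)\<close> increases to \<open>1\<close> for \<open>x > 0\<close> and vanishes for \<open>x \<le> 0\<close>, these bumps are
  dominated by, and converge pointwise to, the indicator of the box with corners \<open>a\<close> and \<open>b\<close>.\<close>

definition box_bump :: "nat \<Rightarrow> complex \<Rightarrow> complex \<Rightarrow> complex \<Rightarrow> complex" where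
  "box_bump n a b z = complex_of_real (
     (flat_exp 0 (real n * (Re z - Re a)) * flat_exp 0 (real n * (Re b - Re z))) *
     (flat_exp 0 (real n * (Im z - Im a)) * flat_exp 0 (real n * (Im b - Im z))))"

lemma flat_exp_0_bounds: "0 \<le> flat_exp 0 x" "flat_exp 0 x \<le> 1"
  by (auto simp: flat_exp_def)

lemma box_bump_outside: "z \<notin> box a b \<Longrightarrow> box_bump n a b z = 0"
  by (auto simp: box_bump_def flat_exp_def in_box_complex_iff zero_less_mult_iff)

lemma norm_box_bump_le_1: "norm (box_bump n a b z) \<le> 1"
  unfolding box_bump_def norm_of_real abs_mult
  by (intro mult_le_one mult_nonneg_nonneg abs_ge_zero) (use flat_exp_0_bounds in auto)

lemma box_bump_test_function: "box_bump n a b \<in> test_functions"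
proof -
  have lin: "(\<lambda>x. flat_exp 0 (real n * (x - c))) \<in> flat_algebra"
      "(\<lambda>x. flat_exp 0 (real n * (c - x))) \<in> flat_algebra" for c
    using flat_algebra.flat[of 0 "real n" "- real n * c"] flat_algebra.flat[of 0 "- real n" "real n * c"]
    by (simp_all add: algebra_simps)
  have "Ck k (box_bump n a b)" for k
    unfolding box_bump_def[abs_def]
    by (rule Ck_flat_product[of "\<lambda>x. flat_exp 0 (real n * (x - Re a)) * flat_exp 0 (real n * (Re b - x))"
          "\<lambda>x. flat_exp 0 (real n * (x - Im a)) * flat_exp 0 (real n * (Im b - x))"])
       (intro flat_algebra.mult lin)+
  moreover have "{z. box_bump n a b z \<noteq> 0} \<subseteq> box a b"
    using box_bump_outside by blast
  then have "bounded {z. box_bump n a b z \<noteq> 0}" by (rule bounded_subset[OF bounded_box])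
  ultimately show ?thesis by (simp add: test_functions_def compact_closure)
qed

lemma box_bump_tendsto: "(\<lambda>n. box_bump n a b z) \<longlonglongrightarrow> indicator (box a b) z"
proof (cases "z \<in> box a b")
  case True
  have lim: "(\<lambda>n. flat_exp 0 (real n * x)) \<longlonglongrightarrow> 1" if "0 < x" for x
  proof -
    have "(\<lambda>n. exp (- (inverse (real n) / x))) \<longlonglongrightarrow> exp (- (0 / x))"
      by (intro tendsto_intros lim_inverse_n) (use that in auto)
    then show ?thesis
      by (simp, elim Lim_transform_eventually)
         (use that in \<open>auto simp: flat_exp_def eventually_sequentially field_simps intro!: exI[of _ 1]\<close>)
  qed
  have "(\<lambda>n. box_bump n a b z) \<longlonglongrightarrow> complex_of_real ((1 * 1) * (1 * 1))"
    unfolding box_bump_def by (intro tendsto_of_real tendsto_mult lim) (use True in \<open>auto simp: in_box_complex_iff\<close>)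
  then show ?thesis using True by simp
qed (simp add: box_bump_outside)

text \<open>Testing against the bumps and passing to the limit shows that \<open>v\<close> has integral zero over every
  sub-box. Boxes form an intersection-stable generator of the Borel sets, hence all set integrals vanish.\<close>

lemma AE_zero_on_box:
  assumes int: "set_integrable lebesgue (box a b) v"
    and zero: "\<And>\<phi>. \<phi> \<in> test_functions \<Longrightarrow> (\<And>z. z \<notin> box a b \<Longrightarrow> \<phi> z = 0) \<Longrightarrow>
        (LINT z|lebesgue. v z * \<phi> z) = 0"
  shows "AE z in lebesgue. z \<in> box a b \<longrightarrow> v z = (0::complex)"
proof -
  \<comment> \<open>Cut off outside the box, so that all integrals below make sense on the whole plane.\<close>
  define u where "u z = indicator (box a b) z *\<^sub>R v z" for z
  have u: "integrable lebesgue u" using int by (simp add: u_def[abs_def] set_integrable_def)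
  have box0: "set_lebesgue_integral lebesgue (box c d) u = 0" if sub: "box c d \<subseteq> box a b" for c d
  proof -
    have "(\<lambda>n. LINT z|lebesgue. u z * box_bump n c d z) \<longlonglongrightarrow> (LINT z|lebesgue. u z * indicator (box c d) z)"
    proof (rule integral_dominated_convergence[where w="\<lambda>z. norm (u z)"])
      have cont_b: "continuous_on UNIV (box_bump n c d)" for n
        using box_bump_test_function[of n c d] unfolding test_functions_def by (metis (mono_tags) Ck.simps(1) mem_Collect_eq)
      have [measurable]: "u \<in> borel_measurable lebesgue" using u by (rule borel_measurable_integrable)
      have [measurable]: "box_bump n c d \<in> borel_measurable lebesgue" for n
        by (intro measurable_completion) (simp add: borel_measurable_continuous_onI cont_b)
      show "(\<lambda>z. u z * box_bump n c d z) \<in> borel_measurable lebesgue" for n by measurable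
      show "(\<lambda>z. u z * indicator (box c d) z) \<in> borel_measurable lebesgue"
        by (intro borel_measurable_times borel_measurable_indicator) auto
      show "AE z in lebesgue. norm (u z * box_bump n c d z) \<le> norm (u z)" for n
        using norm_box_bump_le_1 by (auto simp: norm_mult intro!: mult_left_le)
      show "AE z in lebesgue. (\<lambda>n. u z * box_bump n c d z) \<longlonglongrightarrow> u z * indicator (box c d) z"
        by (intro AE_I2 tendsto_mult tendsto_const box_bump_tendsto)
    qed (use u in auto)
    moreover have "(LINT z|lebesgue. u z * box_bump n c d z) = 0" for n
    proof -
      have "u z * box_bump n c d z = v z * box_bump n c d z" for z
        using box_bump_outside[of z c d n] sub by (cases "z \<in> box c d") (auto simp: u_def)
      then show ?thesis using zero[OF box_bump_test_function] box_bump_outside sub by (metis (no_types, lifting) Bochner_Integration.integral_cong subsetD)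
    qed
    ultimately have "(LINT z|lebesgue. u z * indicator (box c d) z) = 0"
      by (simp add: LIMSEQ_const_iff)
    moreover have "u z * indicator (box c d) z = indicator (box c d) z *\<^sub>R u z" for z
      by (auto simp: indicator_def)
    ultimately show ?thesis by (simp add: set_lebesgue_integral_def)
  qed
  have box1: "set_lebesgue_integral lebesgue (box c d) u = 0" for c d
  proof -
    define e where "e = Complex (max (Re a) (Re c)) (max (Im a) (Im c))"
    define f where "f = Complex (min (Re b) (Re d)) (min (Im b) (Im d))"
    have eq: "box e f = box a b \<inter> box c d" by (auto simp: in_box_complex_iff e_def f_def)
    have "set_lebesgue_integral lebesgue (box c d) u = set_lebesgue_integral lebesgue (box e f) u"
      unfolding set_lebesgue_integral_def
      by (intro Bochner_Integration.integral_cong refl) (auto simp: eq u_def indicator_def)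
    then show ?thesis using box0[of e f] eq by auto
  qed
  have UNIV0: "integral\<^sup>L lebesgue u = 0"
  proof -
    have "integral\<^sup>L lebesgue u = set_lebesgue_integral lebesgue (box a b) u"
      unfolding set_lebesgue_integral_def
      by (intro Bochner_Integration.integral_cong refl) (auto simp: u_def indicator_def)
    then show ?thesis using box1 by simp
  qed
  have si: "set_integrable lebesgue A u" if "A \<in> sets lebesgue" for A
    unfolding set_integrable_def using that u by (rule integrable_mult_indicator)
  have borel0: "set_lebesgue_integral lebesgue A u = 0" if "A \<in> sets borel" for A
  proof -
    have gen: "sets (borel :: complex measure) = sigma_sets UNIV (range (\<lambda>(c, d). box c d))"
      by (simp add: borel_eq_box)
    have stable: "Int_stable (range (\<lambda>(c, d). box c (d::complex)))"
    proof (rule Int_stableI)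
      fix A B assume "A \<in> range (\<lambda>(c, d). box c (d::complex))" "B \<in> range (\<lambda>(c, d). box c (d::complex))"
      then obtain c d e f where AB: "A = box c d" "B = box e f" by auto
      have "A \<inter> B = box (Complex (max (Re c) (Re e)) (max (Im c) (Im e))) (Complex (min (Re d) (Re f)) (min (Im d) (Im f)))"
        by (auto simp: AB in_box_complex_iff)
      then show "A \<inter> B \<in> range (\<lambda>(c, d). box c (d::complex))" by auto
    qed
    have leb: "A \<in> sets lebesgue" if "A \<in> sigma_sets UNIV (range (\<lambda>(c, d). box c (d::complex)))" for A
      using that gen by auto
    have A_gen: "A \<in> sigma_sets UNIV (range (\<lambda>(c, d). box c d))" using that gen by auto
    have sub: "range (\<lambda>(c, d). box c (d::complex)) \<subseteq> Pow UNIV" by simp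
    from stable sub A_gen show ?thesis
    proof (induction rule: sigma_sets_induct_disjoint)
      case (basic A) then show ?case using box1 by auto
    next
      case empty show ?case by (simp add: set_lebesgue_integral_def)
    next
      case (compl A)
      have "set_lebesgue_integral lebesgue (UNIV - A) u = integral\<^sup>L lebesgue (\<lambda>z. u z - indicator A z *\<^sub>R u z)"
        unfolding set_lebesgue_integral_def by (intro Bochner_Integration.integral_cong) (auto simp: indicator_def)
      also have "\<dots> = integral\<^sup>L lebesgue u - set_lebesgue_integral lebesgue A u"
        unfolding set_lebesgue_integral_def
        using u si[OF leb[OF compl(1)]] by (intro Bochner_Integration.integral_diff) (auto simp: set_integrable_def)
      finally show ?case using compl UNIV0 by simp
    next
      case (union A)
      have Ai: "A i \<in> sets lebesgue" for i using union(2) leb by blast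
      have "(\<Union>i. A i) \<in> sets lebesgue" using Ai by blast
      then have "set_lebesgue_integral lebesgue (\<Union>i. A i) u = (\<Sum>i. set_lebesgue_integral lebesgue (A i) u)"
        using union(1) Ai si[of "\<Union>i. A i"]
        by (intro lebesgue_integral_countable_add) (auto simp: disjoint_family_on_def)
      then show ?case using union by simp
    qed
  qed
  have "AE z in lebesgue. u z = 0"
  proof (rule sigma_finite_measure.density_zero[OF _ u])
    fix A :: "complex set" assume "A \<in> sets lebesgue"
    then obtain S N N' where A: "A = S \<union> N" "N \<subseteq> N'" "N' \<in> null_sets lborel" "S \<in> sets lborel"
      by (auto elim: sets_completionE)
    have "AE z in lebesgue. z \<notin> N'" using A(3) by (intro AE_not_in null_sets_completionI)
    then have "set_lebesgue_integral lebesgue A u = set_lebesgue_integral lebesgue S u"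
      unfolding set_lebesgue_integral_def
    proof (intro integral_cong_AE)
      show "(\<lambda>z. indicat_real A z *\<^sub>R u z) \<in> borel_measurable lebesgue"
           "(\<lambda>z. indicat_real S z *\<^sub>R u z) \<in> borel_measurable lebesgue"
        using si[OF \<open>A \<in> sets lebesgue\<close>] si[of S] A(4)
        by (auto simp: set_integrable_def)
    qed (use A in \<open>auto elim!: eventually_mono simp: indicator_def\<close>)
    then show "set_lebesgue_integral lebesgue A u = 0" using borel0 A(4) by simp
  next
    show "sigma_finite_measure (lebesgue :: complex measure)"
    proof
      have "emeasure lebesgue (ball 0 (real n) :: complex set) \<noteq> \<infinity>" for n
        using emeasure_bounded_finite[of "ball 0 (real n) :: complex set"] by simp
      moreover have "(\<Union>n. ball 0 (real n)) = (UNIV :: complex set)"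
        using reals_Archimedean2 by auto
      ultimately show "\<exists>A::complex set set. countable A \<and> A \<subseteq> sets lebesgue \<and> \<Union> A = space lebesgue
          \<and> (\<forall>a\<in>A. emeasure lebesgue a \<noteq> \<infinity>)"
        by (intro exI[of _ "range (\<lambda>n. ball 0 (real n))"]) auto
    qed
  qed
  then show ?thesis by eventually_elim (auto simp: u_def)
qed

section \<open>Weak derivatives of a stretch function\<close>

lemma directional_LIMSEQ:
  fixes f :: "'a::real_normed_vector \<Rightarrow> 'b::real_normed_vector"
  assumes f: "(f has_derivative f') (at z)" and \<epsilon>: "filterlim \<epsilon> (at 0) sequentially"
  shows "(\<lambda>n. (f (z + \<epsilon> n *\<^sub>R e) - f z) /\<^sub>R \<epsilon> n) \<longlonglongrightarrow> f' e"
proof -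
  have "((\<lambda>s::real. z + s *\<^sub>R e) has_derivative (\<lambda>s. s *\<^sub>R e)) (at 0)"
    by (auto intro!: derivative_eq_intros)
  moreover have "(f has_derivative f') (at (z + 0 *\<^sub>R e))" using f by simp
  ultimately have "((\<lambda>s. f (z + s *\<^sub>R e)) has_derivative (\<lambda>s. f' (s *\<^sub>R e))) (at 0)"
    by (rule has_derivative_compose)
  then have "((\<lambda>s. f (z + s *\<^sub>R e)) has_vector_derivative f' e) (at 0)"
    using has_derivative_bounded_linear[OF f]
    by (simp add: has_vector_derivative_def linear_simps(5))
  then have lim: "((\<lambda>s. norm (f (z + s *\<^sub>R e) - f z - s *\<^sub>R f' e) / \<bar>s\<bar>) \<longlongrightarrow> 0) (at 0)"
    by (simp add: has_vector_derivative_def has_derivative_iff_norm)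
  have "((\<lambda>s. (f (z + s *\<^sub>R e) - f z) /\<^sub>R s - f' e) \<longlongrightarrow> 0) (at 0)"
  proof (rule tendsto_norm_zero_cancel, rule Lim_transform_eventually[OF lim])
    have "norm (f (z + s *\<^sub>R e) - f z - s *\<^sub>R f' e) / \<bar>s\<bar> = norm ((f (z + s *\<^sub>R e) - f z) /\<^sub>R s - f' e)"
      if "s \<noteq> 0" for s
    proof -
      have "(f (z + s *\<^sub>R e) - f z) /\<^sub>R s - f' e = (f (z + s *\<^sub>R e) - f z - s *\<^sub>R f' e) /\<^sub>R s"
        using that by (simp add: scaleR_diff_right)
      then show ?thesis by (simp only: norm_scaleR) (simp add: divide_inverse abs_inverse mult.commute)
    qed
    then show "\<forall>\<^sub>F s in at 0. norm (f (z + s *\<^sub>R e) - f z - s *\<^sub>R f' e) / \<bar>s\<bar>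
        = norm ((f (z + s *\<^sub>R e) - f z) /\<^sub>R s - f' e)"
      by (auto simp: eventually_at_filter)
  qed
  then have "((\<lambda>s. (f (z + s *\<^sub>R e) - f z) /\<^sub>R s) \<longlongrightarrow> f' e) (at 0)"
    by (rule LIM_zero_cancel)
  then show ?thesis using \<epsilon> by (rule filterlim_compose)
qed

lemma integrable_continuous_bounded_support:
  fixes f :: "'a::euclidean_space \<Rightarrow> 'b::euclidean_space"
  assumes "continuous_on UNIV f" and "\<And>z. R < norm z \<Longrightarrow> f z = 0"
  shows "integrable lborel f"
proof -
  have "integrable lborel (\<lambda>z. indicator (cball 0 R) z *\<^sub>R f z)"
    using assms(1) by (intro borel_integrable_compact) (auto intro: continuous_on_subset)
  moreover have "(\<lambda>z. indicator (cball 0 R) z *\<^sub>R f z) = f"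
    using assms(2) by (auto simp: indicator_def not_le)
  ultimately show ?thesis by simp
qed

lemma integral_lborel_translate:
  fixes f :: "'a::euclidean_space \<Rightarrow> 'b::euclidean_space"
  assumes "continuous_on UNIV f"
  shows "(\<integral>z. f (z + h) \<partial>lborel) = (\<integral>z. f z \<partial>lborel)"
proof -
  have "(\<integral>z. f z \<partial>lborel) = (\<integral>z. f z \<partial>(distr lborel borel ((+) h)))"
    by (simp add: lborel_distr_plus)
  also have "\<dots> = (\<integral>z. f (h + z) \<partial>lborel)"
    using assms by (intro integral_distr) (auto intro: borel_measurable_continuous_onI)
  finally show ?thesis by (simp add: add.commute)
qed

lemma test_function_facts:
  assumes "\<phi> \<in> test_functions"
  shows "continuous_on UNIV \<phi>"
    and "\<And>z. (\<phi> has_derivative frechet_derivative \<phi> (at z)) (at z)"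
    and "continuous_on UNIV (\<lambda>z. frechet_derivative \<phi> (at z) 1)"
    and "continuous_on UNIV (\<lambda>z. frechet_derivative \<phi> (at z) \<i>)"
proof -
  have "Ck 0 \<phi>" "Ck 1 \<phi>" using assms by (auto simp: test_functions_def simp del: Ck.simps)
  then show "continuous_on UNIV \<phi>"
    and "\<And>z. (\<phi> has_derivative frechet_derivative \<phi> (at z)) (at z)"
    and "continuous_on UNIV (\<lambda>z. frechet_derivative \<phi> (at z) 1)"
    and "continuous_on UNIV (\<lambda>z. frechet_derivative \<phi> (at z) \<i>)"
    by (auto simp: One_nat_def differentiable_on_def frechet_derivative_works)
qed

lemma test_function_support:
  assumes "\<phi> \<in> test_functions"
  obtains R where "R > 0" "\<And>z. R < norm z \<Longrightarrow> \<phi> z = 0"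
proof -
  have "bounded {z. \<phi> z \<noteq> 0}"
    using assms by (auto simp: test_functions_def)
  then obtain R where "R > 0" "\<forall>z\<in>{z. \<phi> z \<noteq> 0}. norm z \<le> R" using bounded_pos by metis
  then show thesis by (intro that[of R]) force+
qed

text \<open>The operator norm of the derivative at a point is controlled by the two partial derivatives, which
  are continuous and therefore bounded on discs.\<close>

lemma test_function_lipschitz:
  assumes \<phi>: "\<phi> \<in> test_functions"
  obtains B where "B-lipschitz_on (cball 0 R) \<phi>"
proof -
  note t = test_function_facts[OF \<phi>]
  have "bounded ((\<lambda>z. frechet_derivative \<phi> (at z) 1) ` cball 0 R)"
       "bounded ((\<lambda>z. frechet_derivative \<phi> (at z) \<i>) ` cball 0 R)"
    using t(3,4) by (auto intro!: compact_imp_bounded compact_continuous_image intro: continuous_on_subset)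
  then obtain B1 B2 where B: "\<And>z. z \<in> cball 0 R \<Longrightarrow> norm (frechet_derivative \<phi> (at z) 1) \<le> B1"
      "\<And>z. z \<in> cball 0 R \<Longrightarrow> norm (frechet_derivative \<phi> (at z) \<i>) \<le> B2"
    unfolding bounded_iff by blast
  have "(max 0 (B1 + B2))-lipschitz_on (cball 0 R) \<phi>"
  proof (rule bounded_derivative_imp_lipschitz)
    show "(\<phi> has_derivative frechet_derivative \<phi> (at z)) (at z within cball 0 R)" for z
      using t(2) by (rule has_derivative_at_withinI)
    show "onorm (frechet_derivative \<phi> (at z)) \<le> max 0 (B1 + B2)" if z: "z \<in> cball 0 R" for z
    proof (rule onorm_bound)
      fix h :: complex
      interpret bounded_linear "frechet_derivative \<phi> (at z)"
        using t(2) by (rule has_derivative_bounded_linear)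
      have "h = Re h *\<^sub>R 1 + Im h *\<^sub>R \<i>" by (simp add: complex_eq_iff)
      then have "norm (frechet_derivative \<phi> (at z) h)
          = norm (Re h *\<^sub>R frechet_derivative \<phi> (at z) 1 + Im h *\<^sub>R frechet_derivative \<phi> (at z) \<i>)"
        by (metis add scaleR)
      also have "\<dots> \<le> \<bar>Re h\<bar> * B1 + \<bar>Im h\<bar> * B2"
        by (rule norm_triangle_le) (use B[OF z] in \<open>auto intro!: add_mono mult_left_mono\<close>)
      also have "\<dots> \<le> norm h * B1 + norm h * B2"
        using B[OF z] norm_ge_zero order_trans
        by (intro add_mono mult_right_mono abs_Re_le_cmod abs_Im_le_cmod) blast+
      also have "\<dots> \<le> max 0 (B1 + B2) * norm h"
        unfolding distrib_left[symmetric] by (subst mult.commute) (intro mult_right_mono, auto)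
      finally show "norm (frechet_derivative \<phi> (at z) h) \<le> max 0 (B1 + B2) * norm h" .
    qed simp
  qed auto
  then show thesis by (rule that)
qed

text \<open>The radial profile of a stretch function, normalised to vanish on the negative half-line, where a
  stretch function does not see it. This makes the profile continuous, hence Borel, on the whole line.\<close>

locale stretch_profile =
  fixes g :: "real \<Rightarrow> real"
  assumes nonneg: "0 \<le> g r"
    and nonpos: "r \<le> 0 \<Longrightarrow> g r = 0"
    and loc_lip: "0 < r \<Longrightarrow> \<exists>\<epsilon>>0. \<exists>C. C-lipschitz_on (ball r \<epsilon> \<inter> {0<..}) g"
    and at_0: "(g \<longlongrightarrow> 0) (at_right 0)"
begin

definition stretch :: "complex \<Rightarrow> complex" where
  "stretch z = of_real (g (norm z)) * sgn z"

text \<open>Agrees with the derivative of \<open>g\<close> wherever that exists, and is Borel measurable everywhere as a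
  limit of continuous functions; so measurability never depends on the exceptional null set.\<close>

definition slope :: "real \<Rightarrow> real" where
  "slope r = lim (\<lambda>n. real (Suc n) * (g (r + 1 / real (Suc n)) - g r))"

text \<open>The directional derivative of the stretch function in direction \<open>e\<close>: the radial component
  of \<open>e\<close> is scaled by \<open>g'\<close>, the tangential one by \<open>g r / r\<close>.\<close>

definition partial :: "complex \<Rightarrow> complex \<Rightarrow> complex" where
  "partial e z = of_real (slope (norm z) * (sgn z \<bullet> e)) * sgn z +
     of_real (g (norm z) / norm z) * (e - of_real (sgn z \<bullet> e) * sgn z)"

lemma lipschitz_Icc:
  assumes "0 < a"
  obtains C where "C-lipschitz_on {a..b} g"
proof -
  have "local_lipschitz {0::real} {a..b} (\<lambda>_. g)"
  proof (rule local_lipschitzI)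
    fix t r :: real assume "r \<in> {a..b}"
    then obtain \<epsilon> C where \<epsilon>: "\<epsilon> > 0" "C-lipschitz_on (ball r \<epsilon> \<inter> {0<..}) g"
      using loc_lip[of r] assms by auto
    have "cball r (\<epsilon> / 2) \<inter> {a..b} \<subseteq> ball r \<epsilon> \<inter> {0<..}" using \<epsilon>(1) assms by auto
    with \<epsilon>(2) have "C-lipschitz_on (cball r (\<epsilon> / 2) \<inter> {a..b}) g" by (rule lipschitz_on_subset)
    then show "\<exists>u>0. \<exists>L. \<forall>t\<in>cball t u \<inter> {0::real}. L-lipschitz_on (cball r u \<inter> {a..b}) g"
      using \<epsilon>(1) by (intro exI[of _ "\<epsilon> / 2"]) auto
  qed
  then obtain C where "\<And>t. t \<in> {0::real} \<Longrightarrow> C-lipschitz_on {a..b} g"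
    by (rule local_lipschitz_compact_implies_lipschitz) auto
  then show thesis using that by blast
qed

lemma continuous_g: "continuous_on UNIV g"
proof -
  have "isCont g r" for r
  proof (cases r "0::real" rule: linorder_cases)
    case less
    have "(g \<longlongrightarrow> g r) (at r)"
      by (rule Lim_transform_within_open[of "\<lambda>_. g r" _ _ _ "{..<0}"])
         (use less nonpos in auto)
    then show ?thesis by (simp add: isCont_def)
  next
    case equal
    have "(g \<longlongrightarrow> 0) (at_left 0)"
      by (rule Lim_transform_eventually[OF tendsto_const])
         (use nonpos in \<open>auto simp: eventually_at_filter\<close>)
    with at_0 show ?thesis using equal nonpos[of 0]
      by (simp add: isCont_def filterlim_split_at)
  next
    case greater
    obtain C where "C-lipschitz_on {r/2..2*r} g" using lipschitz_Icc[of "r/2" "2*r"] greater by auto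
    then have "continuous_on {r/2..2*r} g" by (rule lipschitz_on_continuous_on)
    then show ?thesis by (rule continuous_on_interior) (use greater in auto)
  qed
  then show ?thesis by (simp add: continuous_at_imp_continuous_on)
qed

lemma measurable_g [measurable]: "g \<in> borel_measurable borel"
  using continuous_g by (rule borel_measurable_continuous_onI)

lemma measurable_slope [measurable]: "slope \<in> borel_measurable borel"
  unfolding slope_def[abs_def] by measurable

lemma slope_eq:
  assumes "(g has_real_derivative t) (at r)"
  shows "slope r = t"
proof -
  have \<epsilon>: "filterlim (\<lambda>n. 1 / real (Suc n)) (at 0) sequentially"
    unfolding filterlim_at using LIMSEQ_inverse_real_of_nat by (simp add: inverse_eq_divide)
  have "(\<lambda>n. (g (r + (1 / real (Suc n)) *\<^sub>R 1) - g r) /\<^sub>R (1 / real (Suc n))) \<longlonglongrightarrow> t * 1"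
    by (rule directional_LIMSEQ[OF assms[unfolded has_field_derivative_def] \<epsilon>])
  then show ?thesis unfolding slope_def by (intro limI) (simp add: divide_simps)
qed

lemma AE_differentiable:
  "AE r in lborel. 0 < r \<longrightarrow> (g has_real_derivative slope r) (at r)"
proof -
  have "AE r in lborel. 1 / real (Suc n) < r \<and> r < real n \<longrightarrow> g differentiable (at r)" for n
  proof -
    define a b where "a = 1 / real (Suc n)" and "b = max a (real n)"
    obtain C where C: "C-lipschitz_on {a..b} g" using lipschitz_Icc[of a b] by (auto simp: a_def)
    have "C-lipschitz_on UNIV (\<lambda>x. g (max a (min b x)))"
    proof (rule lipschitz_onI)
      show "dist (g (max a (min b x))) (g (max a (min b y))) \<le> C * dist x y" for x y
      proof -
        have "dist (g (max a (min b x))) (g (max a (min b y))) \<le> C * dist (max a (min b x)) (max a (min b y))"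
          by (rule lipschitz_onD[OF C]) (auto simp: b_def)
        also have "\<dots> \<le> C * dist x y"
          using lipschitz_on_nonneg[OF C] by (intro mult_left_mono) (auto simp: dist_real_def max_def min_def)
        finally show ?thesis .
      qed
      show "0 \<le> C" using C by (rule lipschitz_on_nonneg)
    qed
    then have "AE x in lborel. (\<lambda>x. g (max a (min b x))) differentiable at x"
      by (rule AE_differentiable_lipschitz)
    then show ?thesis
    proof eventually_elim
      case (elim x)
      show ?case
      proof
        assume x: "1 / real (Suc n) < x \<and> x < real n"
        obtain D where "((\<lambda>x. g (max a (min b x))) has_derivative D) (at x)"
          using elim by (auto simp: differentiable_def)
        then have "(g has_derivative D) (at x)"
          by (rule has_derivative_transform_within_open[where s="{a<..<b}"])
             (use x in \<open>auto simp: a_def b_def\<close>)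
        then show "g differentiable (at x)" by (auto simp: differentiable_def)
      qed
    qed
  qed
  then have "AE r in lborel. \<forall>n. 1 / real (Suc n) < r \<and> r < real n \<longrightarrow> g differentiable (at r)"
    unfolding AE_all_countable by blast
  then show ?thesis
  proof eventually_elim
    case (elim r)
    show ?case
    proof
      assume "0 < r"
      obtain n1 where n1: "1 / real (Suc n1) < r"
        using reals_Archimedean[OF \<open>0 < r\<close>] by (auto simp: inverse_eq_divide)
      obtain n2 :: nat where n2: "r < real n2" using reals_Archimedean2 by blast
      define n where "n = max n1 n2"
      have "1 / real (Suc n) \<le> 1 / real (Suc n1)" by (auto simp: n_def frac_le)
      moreover have "real n2 \<le> real n" by (simp add: n_def)
      ultimately have "g differentiable (at r)" using elim n1 n2 by (meson le_less_trans less_le_trans)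
      then show "(g has_real_derivative slope r) (at r)"
        using slope_eq by (metis real_differentiable_def)
    qed
  qed
qed

lemma AE_differentiable_norm:
  "AE z in lborel. z \<noteq> (0::complex) \<longrightarrow> (g has_real_derivative slope (norm z)) (at (norm z))"
  by (rule AE_norm_complex[OF AE_differentiable])

lemma norm_stretch: "norm (stretch z) = g (norm z)"
  using nonneg[of "norm z"] nonpos[of 0] by (simp add: stretch_def norm_mult norm_sgn)

lemma continuous_stretch: "continuous_on UNIV stretch"
proof -
  have "isCont stretch z" for z
  proof (cases "z = 0")
    case True
    have "((\<lambda>w::complex. g (norm w)) \<longlongrightarrow> g (norm (0::complex))) (at 0)"
      using continuous_g by (intro continuous_on_tendsto_compose[of UNIV g] tendsto_intros) auto
    then have "((\<lambda>w. norm (stretch w)) \<longlongrightarrow> 0) (at 0)" using nonpos[of 0] by (simp add: norm_stretch)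
    then have "(stretch \<longlongrightarrow> 0) (at 0)" by (rule tendsto_norm_zero_cancel)
    then show ?thesis using True by (simp add: isCont_def stretch_def)
  next
    case False
    have "isCont (\<lambda>w. g (norm w)) z"
      using continuous_g by (intro isCont_o2[OF continuous_norm[OF continuous_ident]])
        (simp add: continuous_on_eq_continuous_at)
    then show ?thesis
      using False unfolding stretch_def[abs_def] sgn_div_norm
      by (intro continuous_intros) auto
  qed
  then show ?thesis by (simp add: continuous_at_imp_continuous_on)
qed

text \<open>Both factors of \<open>g \<bar>z\<bar> * sgn z\<close> are bounded and Lipschitz on the annulus; for \<open>sgn\<close> the constant is
  \<open>2 / a\<close>.\<close>

lemma stretch_lipschitz_annulus:
  assumes "0 < a"
  obtains K where "0 \<le> K" "\<And>z w. norm z \<in> {a..b} \<Longrightarrow> norm w \<in> {a..b} \<Longrightarrow> norm (stretch z - stretch w) \<le> K * norm (z - w)"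
proof -
  obtain C where C: "C-lipschitz_on {a..b} g" using lipschitz_Icc assms by blast
  have "bounded (g ` {a..b})"
    using continuous_g by (intro compact_imp_bounded compact_continuous_image) (auto intro: continuous_on_subset)
  then obtain M where "\<forall>y\<in>g ` {a..b}. norm y \<le> M" unfolding bounded_iff by blast
  then have M: "g r \<le> M" if "r \<in> {a..b}" for r using that by force
  have C0: "0 \<le> C" using C by (rule lipschitz_on_nonneg)
  show thesis
  proof (rule that[of "C + max 0 M * (2 / a)"])
    show "0 \<le> C + max 0 M * (2 / a)" using C0 assms by simp
  next
    fix z w :: complex assume zw: "norm z \<in> {a..b}" "norm w \<in> {a..b}"
    have pos: "0 < norm z" "0 < norm w" using zw assms by auto
    have "norm (sgn z - sgn w) \<le> 2 / a * norm (z - w)"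
    proof -
      \<comment> \<open>First \<open>z\<close> is replaced by \<open>w\<close> in the numerator of \<open>z / \<bar>z\<bar>\<close>, then in the denominator.\<close>
      have "sgn z - sgn w = (z - w) /\<^sub>R norm z + ((norm w - norm z) / norm z) *\<^sub>R sgn w"
        using pos by (simp add: sgn_div_norm field_simps scaleR_conv_of_real)
      also have "norm \<dots> \<le> norm (z - w) / norm z + \<bar>norm w - norm z\<bar> / norm z"
        by (rule norm_triangle_le) (use pos in \<open>auto simp: norm_sgn divide_inverse abs_mult mult.commute\<close>)
      also have "\<dots> \<le> norm (z - w) / norm z + norm (z - w) / norm z"
        using norm_triangle_ineq3[of w z] by (intro add_mono divide_right_mono) (auto simp: norm_minus_commute)
      also have "\<dots> \<le> norm (z - w) / a + norm (z - w) / a"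
        by (intro add_mono divide_left_mono mult_pos_pos pos assms) (use zw in auto)
      finally show ?thesis by (simp add: field_simps)
    qed
    then have 1: "norm (of_real (g (norm w)) * (sgn z - sgn w)) \<le> max 0 M * (2 / a * norm (z - w))"
      unfolding norm_mult norm_of_real
      by (intro mult_mono) (use M[OF zw(2)] nonneg[of "norm w"] in auto)
    have "\<bar>g (norm z) - g (norm w)\<bar> \<le> C * \<bar>norm z - norm w\<bar>"
      using lipschitz_onD[OF C zw] by (simp add: dist_real_def)
    also have "\<dots> \<le> C * norm (z - w)" using C0 by (intro mult_left_mono norm_triangle_ineq3)
    finally have 2: "norm (of_real (g (norm z) - g (norm w)) * sgn z) \<le> C * norm (z - w)"
      using pos unfolding norm_mult norm_of_real by (simp add: norm_sgn)
    have "stretch z - stretch w = of_real (g (norm z) - g (norm w)) * sgn z + of_real (g (norm w)) * (sgn z - sgn w)"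
      by (simp add: stretch_def algebra_simps)
    then have "norm (stretch z - stretch w) \<le> C * norm (z - w) + max 0 M * (2 / a * norm (z - w))"
      using norm_triangle_mono[OF 2 1] by simp
    then show "norm (stretch z - stretch w) \<le> (C + max 0 M * (2 / a)) * norm (z - w)"
      by (simp add: algebra_simps)
  qed
qed

lemma stretch_has_derivative:
  assumes z: "z \<noteq> 0" and g': "(g has_real_derivative slope (norm z)) (at (norm z))"
  shows "(stretch has_derivative (\<lambda>e. partial e z)) (at z)"
proof -
  have n: "((\<lambda>w. norm w) has_derivative (\<lambda>h. sgn z \<bullet> h)) (at z)"
    using has_derivative_norm[OF z] by (simp add: inner_commute)
  have "((\<lambda>r. g r / r) has_real_derivative (slope (norm z) * norm z - g (norm z)) / (norm z)\<^sup>2) (at (norm z))"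
    using z by (auto intro!: derivative_eq_intros g' simp: power2_eq_square)
  from has_derivative_compose[OF n this[unfolded has_field_derivative_def]]
  have "((\<lambda>w. g (norm w) / norm w) has_derivative
      (\<lambda>h. (slope (norm z) * norm z - g (norm z)) / (norm z)\<^sup>2 * (sgn z \<bullet> h))) (at z)" .
  then have "((\<lambda>w. (g (norm w) / norm w) *\<^sub>R w) has_derivative
      (\<lambda>h. (g (norm z) / norm z) *\<^sub>R h +
         ((slope (norm z) * norm z - g (norm z)) / (norm z)\<^sup>2 * (sgn z \<bullet> h)) *\<^sub>R z)) (at z)"
    by (rule has_derivative_scaleR) (rule has_derivative_ident)
  moreover have "(g (norm z) / norm z) *\<^sub>R h +
      ((slope (norm z) * norm z - g (norm z)) / (norm z)\<^sup>2 * (sgn z \<bullet> h)) *\<^sub>R z = partial h z" for h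
  proof -
    have "((slope (norm z) * norm z - g (norm z)) / (norm z)\<^sup>2 * (sgn z \<bullet> h)) *\<^sub>R z
        = ((slope (norm z) - g (norm z) / norm z) * (sgn z \<bullet> h)) *\<^sub>R sgn z"
      using z by (simp add: sgn_div_norm field_simps power2_eq_square)
    then show ?thesis by (simp add: partial_def scaleR_conv_of_real algebra_simps)
  qed
  ultimately have "((\<lambda>w. (g (norm w) / norm w) *\<^sub>R w) has_derivative (\<lambda>e. partial e z)) (at z)"
    by simp
  then show ?thesis
    by (rule has_derivative_transform_within_open[where s=UNIV])
       (auto simp: stretch_def sgn_div_norm scaleR_conv_of_real divide_inverse)
qed

lemma measurable_partial [measurable]: "partial e \<in> borel_measurable borel"
proof -
  have [measurable]: "(\<lambda>z::complex. sgn z) \<in> borel_measurable borel" by (simp add: sgn_div_norm)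
  show ?thesis unfolding partial_def[abs_def] by measurable
qed

text \<open>A limit of difference quotients is bounded by the Lipschitz constant on a slightly larger annulus.\<close>

lemma partial_bounded_on_annulus:
  assumes "0 < a"
  obtains B where "AE z in lborel. norm z \<in> {a..b} \<longrightarrow> norm (partial e z) \<le> B"
proof -
  obtain K where K: "0 \<le> K" "\<And>z w. norm z \<in> {a/2..b+1} \<Longrightarrow> norm w \<in> {a/2..b+1} \<Longrightarrow>
      norm (stretch z - stretch w) \<le> K * norm (z - w)"
    using stretch_lipschitz_annulus[of "a/2" "b+1"] assms by auto
  have "AE z in lborel. norm z \<in> {a..b} \<longrightarrow> norm (partial e z) \<le> K * norm e"
    using AE_differentiable_norm
  proof eventually_elim
    case (elim z)
    show ?case
    proof
      assume z: "norm z \<in> {a..b}"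
      then have "z \<noteq> 0" using assms by auto
      define S :: "complex set" where "S = {w. norm w \<in> {a/2<..<b+1}}"
      have "open S" unfolding S_def greaterThanLessThan_iff by (intro open_Collect_conj open_Collect_less continuous_intros)
      have d: "(stretch has_derivative (\<lambda>e. partial e z)) (at z)"
        using elim \<open>z \<noteq> 0\<close> by (intro stretch_has_derivative) auto
      have "(\<lambda>n. (stretch (z + (1 / real (Suc n)) *\<^sub>R e) - stretch z) /\<^sub>R (1 / real (Suc n))) \<longlonglongrightarrow> partial e z"
        by (rule directional_LIMSEQ[OF d])
           (use LIMSEQ_inverse_real_of_nat in \<open>simp add: filterlim_at inverse_eq_divide\<close>)
      then have "(\<lambda>n. norm ((stretch (z + (1 / real (Suc n)) *\<^sub>R e) - stretch z) /\<^sub>R (1 / real (Suc n)))) \<longlonglongrightarrow> norm (partial e z)"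
        by (rule tendsto_norm)
      moreover have "\<forall>\<^sub>F n in sequentially. norm ((stretch (z + (1 / real (Suc n)) *\<^sub>R e) - stretch z) /\<^sub>R (1 / real (Suc n))) \<le> K * norm e"
      proof -
        have "(\<lambda>n. z + (1 / real (Suc n)) *\<^sub>R e) \<longlonglongrightarrow> z + 0 *\<^sub>R e"
          by (intro tendsto_intros) (use LIMSEQ_inverse_real_of_nat in \<open>simp add: inverse_eq_divide\<close>)
        moreover have "z + 0 *\<^sub>R e \<in> S" using z assms by (auto simp: S_def)
        ultimately have "\<forall>\<^sub>F n in sequentially. z + (1 / real (Suc n)) *\<^sub>R e \<in> S"
          using topological_tendstoD[OF _ \<open>open S\<close>] by blast
        then show ?thesis
        proof eventually_elim
          case (elim n)
          then have "norm (stretch (z + (1 / real (Suc n)) *\<^sub>R e) - stretch z) \<le> K * norm (z + (1 / real (Suc n)) *\<^sub>R e - z)"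
            using z assms by (intro K(2)) (auto simp: S_def)
          also have "\<dots> = K * norm e / real (Suc n)" by simp
          finally show ?case unfolding norm_scaleR
            by (simp add: pos_le_divide_eq mult.commute del: of_nat_Suc)
        qed
      qed
      ultimately show "norm (partial e z) \<le> K * norm e"
        by (intro tendsto_upperbound) auto
    qed
  qed
  then show thesis by (rule that)
qed

text \<open>Translation invariance turns a difference quotient of \<open>f\<close> tested with \<open>\<phi>\<close> into one of \<open>\<phi>\<close> tested
  with \<open>f\<close>. Both converge pointwise almost everywhere, and boundedly since \<open>f\<close> is Lipschitz on
  annuli; the limits are the two sides of the claim.\<close>

lemma stretch_integration_by_parts:
  assumes \<phi>: "\<phi> \<in> test_functions" and a: "0 < a" and supp: "\<And>z. norm z < 2 * a \<Longrightarrow> \<phi> z = 0"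
    and e: "norm e = 1" and cont_d\<phi>: "continuous_on UNIV (\<lambda>z. frechet_derivative \<phi> (at z) e)"
  shows "(\<integral>z. stretch z * frechet_derivative \<phi> (at z) e \<partial>lborel) = - (\<integral>z. partial e z * \<phi> z \<partial>lborel)"
proof -
  note t = test_function_facts[OF \<phi>]
  obtain R where R: "R > 0" "\<And>z. R < norm z \<Longrightarrow> \<phi> z = 0" using test_function_support[OF \<phi>] by blast
  obtain B where B: "B-lipschitz_on (cball 0 (R + 2)) \<phi>" using test_function_lipschitz[OF \<phi>] .
  obtain K where K: "0 \<le> K" "\<And>z w. norm z \<in> {a..R+1} \<Longrightarrow> norm w \<in> {a..R+1} \<Longrightarrow>
      norm (stretch z - stretch w) \<le> K * norm (z - w)"
    using stretch_lipschitz_annulus[OF a] by blast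
  obtain N where N: "1 / real (Suc N) < min a 1"
    using reals_Archimedean[of "min a 1"] a by (auto simp: inverse_eq_divide)
  \<comment> \<open>The shift by \<open>N\<close> keeps translates of the support inside the annulus on which \<open>f\<close> is Lipschitz.\<close>
  define \<epsilon> where "\<epsilon> n = 1 / real (Suc (n + N))" for n
  have \<epsilon>pos: "0 < \<epsilon> n" for n by (simp add: \<epsilon>_def)
  have \<epsilon>le: "\<epsilon> n \<le> a" "\<epsilon> n \<le> 1" for n
  proof -
    have "\<epsilon> n \<le> 1 / real (Suc N)" by (auto simp: \<epsilon>_def frac_le)
    then show "\<epsilon> n \<le> a" "\<epsilon> n \<le> 1" using N unfolding min_less_iff_conj by linarith+
  qed
  have \<epsilon>0: "\<epsilon> \<longlonglongrightarrow> 0"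
    using LIMSEQ_ignore_initial_segment[OF LIMSEQ_inverse_real_of_nat, of N]
    by (simp add: \<epsilon>_def[abs_def] inverse_eq_divide)
  have \<epsilon>: "filterlim \<epsilon> (at 0) sequentially" and m\<epsilon>: "filterlim (\<lambda>n. - \<epsilon> n) (at 0) sequentially"
    using \<epsilon>0 \<epsilon>pos tendsto_minus[OF \<epsilon>0] by (auto simp: filterlim_at less_imp_neq[symmetric])
  have [measurable]: "stretch \<in> borel_measurable borel" "\<phi> \<in> borel_measurable borel"
      "(\<lambda>z. frechet_derivative \<phi> (at z) e) \<in> borel_measurable borel"
    using continuous_stretch t(1) cont_d\<phi> by (auto intro: borel_measurable_continuous_onI)
  define P where "P n z = ((stretch (z + \<epsilon> n *\<^sub>R e) - stretch z) /\<^sub>R \<epsilon> n) * \<phi> z" for n z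
  define Q where "Q n z = stretch z * ((\<phi> (z + (- \<epsilon> n) *\<^sub>R e) - \<phi> z) /\<^sub>R (- \<epsilon> n))" for n z
  have contS: "continuous_on UNIV (\<lambda>z. stretch (z + w))" "continuous_on UNIV (\<lambda>z. \<phi> (z + w))" for w
    by (auto intro!: continuous_on_compose2[OF continuous_stretch] continuous_on_compose2[OF t(1)] continuous_intros)
  have contQ: "continuous_on UNIV (\<lambda>z. stretch z * \<phi> (z - \<epsilon> n *\<^sub>R e))" for n
    using contS(2)[of "- (\<epsilon> n *\<^sub>R e)"] continuous_stretch by (auto intro!: continuous_on_mult)
  have PQ: "(\<integral>z. P n z \<partial>lborel) = - (\<integral>z. Q n z \<partial>lborel)" for n
  proof -
    have i1: "integrable lborel (\<lambda>z. stretch (z + \<epsilon> n *\<^sub>R e) * \<phi> z)" and i2: "integrable lborel (\<lambda>z. stretch z * \<phi> z)"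
      by (rule integrable_continuous_bounded_support[where R=R];
          use R(2) contS continuous_stretch t(1) in \<open>auto intro!: continuous_on_mult\<close>)+
    have i3: "integrable lborel (\<lambda>z. stretch z * \<phi> (z - \<epsilon> n *\<^sub>R e))"
    proof (rule integrable_continuous_bounded_support[where R="R + 1"])
      show "continuous_on UNIV (\<lambda>z. stretch z * \<phi> (z - \<epsilon> n *\<^sub>R e))" by (rule contQ)
      show "stretch z * \<phi> (z - \<epsilon> n *\<^sub>R e) = 0" if "R + 1 < norm z" for z
        using R(2)[of "z - \<epsilon> n *\<^sub>R e"] norm_triangle_ineq2[of z "\<epsilon> n *\<^sub>R e"] that \<epsilon>le(2)[of n] \<epsilon>pos[of n] e by simp
    qed
    have "(\<integral>z. P n z \<partial>lborel) = (\<integral>z. inverse (\<epsilon> n) *\<^sub>R (stretch (z + \<epsilon> n *\<^sub>R e) * \<phi> z - stretch z * \<phi> z) \<partial>lborel)"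
      by (intro Bochner_Integration.integral_cong) (auto simp: P_def algebra_simps)
    also have "\<dots> = inverse (\<epsilon> n) *\<^sub>R ((\<integral>z. stretch (z + \<epsilon> n *\<^sub>R e) * \<phi> z \<partial>lborel) - (\<integral>z. stretch z * \<phi> z \<partial>lborel))"
      using i1 i2 by simp
    also have "(\<integral>z. stretch (z + \<epsilon> n *\<^sub>R e) * \<phi> z \<partial>lborel) = (\<integral>z. stretch z * \<phi> (z - \<epsilon> n *\<^sub>R e) \<partial>lborel)"
      using integral_lborel_translate[OF contQ[of n], of "\<epsilon> n *\<^sub>R e"] by simp
    also have "inverse (\<epsilon> n) *\<^sub>R ((\<integral>z. stretch z * \<phi> (z - \<epsilon> n *\<^sub>R e) \<partial>lborel) - (\<integral>z. stretch z * \<phi> z \<partial>lborel))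
        = (\<integral>z. inverse (\<epsilon> n) *\<^sub>R (stretch z * \<phi> (z - \<epsilon> n *\<^sub>R e) - stretch z * \<phi> z) \<partial>lborel)"
      using i2 i3 by simp
    also have "\<dots> = (\<integral>z. - Q n z \<partial>lborel)"
      by (intro Bochner_Integration.integral_cong) (auto simp: Q_def algebra_simps)
    finally show ?thesis by simp
  qed
  have "(\<lambda>n. \<integral>z. P n z \<partial>lborel) \<longlonglongrightarrow> (\<integral>z. partial e z * \<phi> z \<partial>lborel)"
  proof (rule integral_dominated_convergence[where w="\<lambda>z. K * norm (\<phi> z)"])
    show "integrable lborel (\<lambda>z. K * norm (\<phi> z))"
      by (rule integrable_continuous_bounded_support[where R=R]) (use R(2) t(1) in \<open>auto intro!: continuous_intros\<close>)
    show "P n \<in> borel_measurable lborel" for n unfolding P_def[abs_def] by measurable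
    show "AE z in lborel. (\<lambda>n. P n z) \<longlonglongrightarrow> partial e z * \<phi> z"
      using AE_differentiable_norm
    proof eventually_elim
      case (elim z)
      show ?case
      proof (cases "z = 0")
        case True then show ?thesis using supp[of 0] a by (simp add: P_def)
      next
        case False
        have "(stretch has_derivative (\<lambda>e. partial e z)) (at z)"
          using elim False by (intro stretch_has_derivative) auto
        then show ?thesis unfolding P_def by (intro tendsto_mult tendsto_const directional_LIMSEQ[OF _ \<epsilon>])
      qed
    qed
    show "AE z in lborel. norm (P n z) \<le> K * norm (\<phi> z)" for n
    proof (rule AE_I2)
      fix z
      show "norm (P n z) \<le> K * norm (\<phi> z)"
      proof (cases "\<phi> z = 0")
        case True then show ?thesis by (simp add: P_def)
      next
        case False
        then have z: "2 * a \<le> norm z" "norm z \<le> R" using supp R(2) by (meson not_le)+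
        have ne: "norm (\<epsilon> n *\<^sub>R e) = \<epsilon> n" using e \<epsilon>pos[of n] by simp
        have "norm z - \<epsilon> n \<le> norm (z + \<epsilon> n *\<^sub>R e)" "norm (z + \<epsilon> n *\<^sub>R e) \<le> norm z + \<epsilon> n"
          using norm_triangle_ineq4[of "z + \<epsilon> n *\<^sub>R e" "\<epsilon> n *\<^sub>R e"] norm_triangle_ineq[of z "\<epsilon> n *\<^sub>R e"] ne by auto
        then have "norm (stretch (z + \<epsilon> n *\<^sub>R e) - stretch z) \<le> K * norm (z + \<epsilon> n *\<^sub>R e - z)"
          using z a \<epsilon>le[of n] by (intro K(2)) auto
        then have "norm ((stretch (z + \<epsilon> n *\<^sub>R e) - stretch z) /\<^sub>R \<epsilon> n) \<le> K"
          using ne \<epsilon>pos[of n] by (simp add: divide_simps)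
        then show ?thesis unfolding P_def norm_mult by (intro mult_right_mono) auto
      qed
    qed
  qed measurable
  moreover have "(\<lambda>n. \<integral>z. Q n z \<partial>lborel) \<longlonglongrightarrow> (\<integral>z. stretch z * frechet_derivative \<phi> (at z) e \<partial>lborel)"
  proof (rule integral_dominated_convergence[where w="\<lambda>z. indicator (cball 0 (R + 1)) z *\<^sub>R (norm (stretch z) * B)"])
    show "integrable lborel (\<lambda>z. indicator (cball 0 (R + 1)) z *\<^sub>R (norm (stretch z) * B))"
      by (rule borel_integrable_compact)
         (auto intro!: continuous_intros intro: continuous_on_subset[OF continuous_stretch])
    show "Q n \<in> borel_measurable lborel" for n unfolding Q_def[abs_def] by measurable
    show "AE z in lborel. (\<lambda>n. Q n z) \<longlonglongrightarrow> stretch z * frechet_derivative \<phi> (at z) e"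
      unfolding Q_def by (intro AE_I2 tendsto_mult tendsto_const directional_LIMSEQ[OF t(2) m\<epsilon>])
    show "AE z in lborel. norm (Q n z) \<le> indicator (cball 0 (R + 1)) z *\<^sub>R (norm (stretch z) * B)" for n
    proof (rule AE_I2)
      fix z
      have ne: "norm ((- \<epsilon> n) *\<^sub>R e) = \<epsilon> n" using e \<epsilon>pos[of n] by simp
      have le: "norm (z + (- \<epsilon> n) *\<^sub>R e) \<le> norm z + 1" "norm z - 1 \<le> norm (z + (- \<epsilon> n) *\<^sub>R e)"
        using norm_triangle_ineq[of z "(- \<epsilon> n) *\<^sub>R e"] norm_triangle_ineq4[of "z + (- \<epsilon> n) *\<^sub>R e" "(- \<epsilon> n) *\<^sub>R e"]
          ne \<epsilon>le(2)[of n] by auto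
      show "norm (Q n z) \<le> indicator (cball 0 (R + 1)) z *\<^sub>R (norm (stretch z) * B)"
      proof (cases "norm z \<le> R + 1")
        case True
        have "dist (\<phi> (z + (- \<epsilon> n) *\<^sub>R e)) (\<phi> z) \<le> B * dist (z + (- \<epsilon> n) *\<^sub>R e) z"
          using True le R(1) by (intro lipschitz_onD[OF B]) auto
        then have "norm ((\<phi> (z + (- \<epsilon> n) *\<^sub>R e) - \<phi> z) /\<^sub>R (- \<epsilon> n)) \<le> B"
          using ne \<epsilon>pos[of n] by (simp add: dist_norm divide_simps)
        then show ?thesis using True unfolding Q_def norm_mult by (auto intro!: mult_left_mono)
      next
        case False
        then have "\<phi> z = 0" "\<phi> (z + (- \<epsilon> n) *\<^sub>R e) = 0" using le by (auto intro!: R(2))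
        then show ?thesis using False by (simp add: Q_def)
      qed
    qed
  qed measurable
  then have "(\<lambda>n. - (\<integral>z. Q n z \<partial>lborel)) \<longlonglongrightarrow> - (\<integral>z. stretch z * frechet_derivative \<phi> (at z) e \<partial>lborel)"
    by (rule tendsto_minus)
  ultimately have "(\<integral>z. partial e z * \<phi> z \<partial>lborel) = - (\<integral>z. stretch z * frechet_derivative \<phi> (at z) e \<partial>lborel)"
    unfolding PQ by (rule LIMSEQ_unique)
  then show ?thesis by simp
qed

text \<open>A box strictly on one side of the imaginary axis stays away from the origin, so test functions
  supported in it are admissible in the integration by parts.\<close>

lemma weak_partial_eq_on_box:
  assumes u: "has_weak_partial stretch e u" and e: "e \<in> {1, \<i>}"
    and box: "0 < Re a \<or> Re b < 0"
  shows "AE z in lebesgue. z \<in> box a b \<longrightarrow> u z = partial e z"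
proof -
  define c where "c = (if 0 < Re a then Re a else - Re b) / 2"
  have c: "0 < c" using box by (auto simp: c_def)
  have cbox_ge: "2 * c \<le> norm z" if "z \<in> cbox a b" for z
    using that box abs_Re_le_cmod[of z] by (auto simp: c_def in_cbox_complex_iff)
  obtain R where R: "\<And>z. z \<in> cbox a b \<Longrightarrow> norm z \<le> R"
    using bounded_cbox[of a b] unfolding bounded_iff by blast
  obtain B where B: "AE z in lborel. norm z \<in> {2*c..R} \<longrightarrow> norm (partial e z) \<le> B"
    using partial_bounded_on_annulus[of "2*c" R e] c by auto
  have [measurable]: "partial e \<in> borel_measurable lebesgue"
    using measurable_partial by (intro measurable_completion) simp
  have sub: "z \<in> box a b \<Longrightarrow> z \<in> cbox a b" for z using box_subset_cbox by blast
  have int_u: "set_integrable lebesgue (box a b) u"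
  proof (rule set_integrable_subset)
    show "set_integrable lebesgue (cbox a b) u"
      using u compact_cbox[of a b] unfolding has_weak_partial_def locally_integrable_def by blast
  qed (auto simp: box_subset_cbox)
  have int_p: "set_integrable lebesgue (box a b) (partial e)"
    unfolding set_integrable_def
  proof (rule integrableI_bounded_set_indicator[where B=B])
    show "AE z in lebesgue. z \<in> box a b \<longrightarrow> norm (partial e z) \<le> B"
      using AE_completion[OF B] by eventually_elim (use sub cbox_ge R in auto)
  qed (auto simp: emeasure_lborel_box_eq)
  have "AE z in lebesgue. z \<in> box a b \<longrightarrow> u z - partial e z = 0"
  proof (rule AE_zero_on_box)
    show "set_integrable lebesgue (box a b) (\<lambda>z. u z - partial e z)"
      using int_u int_p by (rule set_integral_diff)
    fix \<phi> assume \<phi>: "\<phi> \<in> test_functions" and supp: "\<And>z. z \<notin> box a b \<Longrightarrow> \<phi> z = 0"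
    note t = test_function_facts[OF \<phi>]
    have [measurable]: "\<phi> \<in> borel_measurable lebesgue"
      by (intro measurable_completion) (simp add: borel_measurable_continuous_onI t(1))
    have "bounded (\<phi> ` cbox a b)"
      using t(1) by (intro compact_imp_bounded compact_continuous_image) (auto intro: continuous_on_subset)
    then obtain M where M: "\<forall>y\<in>\<phi> ` cbox a b. norm y \<le> M" unfolding bounded_iff by blast
    have int: "integrable lebesgue (\<lambda>z. v z * \<phi> z)" if v: "set_integrable lebesgue (box a b) v" for v
    proof -
      have eq: "v z * \<phi> z = (indicator (box a b) z *\<^sub>R v z) * \<phi> z" for z
        using supp[of z] by (auto simp: indicator_def)
      have v': "integrable lebesgue (\<lambda>z. indicator (box a b) z *\<^sub>R v z)" using v by (simp add: set_integrable_def)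
      show ?thesis
      proof (rule Bochner_Integration.integrable_bound)
        show "integrable lebesgue (\<lambda>z. M *\<^sub>R (indicator (box a b) z *\<^sub>R v z))"
          using v' by (rule integrable_scaleR_right)
        show "(\<lambda>z. v z * \<phi> z) \<in> borel_measurable lebesgue"
          unfolding eq using v' by (intro borel_measurable_times) auto
        show "AE z in lebesgue. norm (v z * \<phi> z) \<le> norm (M *\<^sub>R (indicator (box a b) z *\<^sub>R v z))"
        proof (rule AE_I2)
          fix z show "norm (v z * \<phi> z) \<le> norm (M *\<^sub>R (indicator (box a b) z *\<^sub>R v z))"
          proof (cases "z \<in> box a b")
            case True
            then have "norm (\<phi> z) \<le> \<bar>M\<bar>" using M sub by fastforce
            then show ?thesis using True by (simp add: norm_mult mult.commute mult_right_mono)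
          qed (simp add: supp)
        qed
      qed
    qed
    have cont_e: "continuous_on UNIV (\<lambda>z. frechet_derivative \<phi> (at z) e)" using e t(3,4) by auto
    have "(LINT z|lebesgue. (u z - partial e z) * \<phi> z) = (LINT z|lebesgue. u z * \<phi> z) - (LINT z|lebesgue. partial e z * \<phi> z)"
      using int[OF int_u] int[OF int_p] by (simp add: left_diff_distrib)
    also have "(LINT z|lebesgue. u z * \<phi> z) = - (LINT z|lebesgue. stretch z * frechet_derivative \<phi> (at z) e)"
      using u \<phi> by (simp add: has_weak_partial_def)
    also have "(LINT z|lebesgue. stretch z * frechet_derivative \<phi> (at z) e) = (\<integral>z. stretch z * frechet_derivative \<phi> (at z) e \<partial>lborel)"
      by (rule integral_completion) (auto intro!: borel_measurable_continuous_onI continuous_on_mult continuous_stretch cont_e)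
    also have "\<dots> = - (\<integral>z. partial e z * \<phi> z \<partial>lborel)"
    proof (rule stretch_integration_by_parts[OF \<phi> c _ _ cont_e])
      show "\<phi> z = 0" if "norm z < 2 * c" for z using that cbox_ge[of z] sub[of z] supp[of z] by auto
      show "norm e = 1" using e by auto
    qed
    also have "(\<integral>z. partial e z * \<phi> z \<partial>lborel) = (LINT z|lebesgue. partial e z * \<phi> z)"
      using measurable_partial[of e] borel_measurable_continuous_onI[OF t(1)]
      by (intro integral_completion[symmetric] borel_measurable_times) simp_all
    finally show "(LINT z|lebesgue. (u z - partial e z) * \<phi> z) = 0" by simp
  qed
  then show ?thesis by eventually_elim auto
qed

text \<open>Countably many such boxes exhaust the complement of the imaginary axis, which is a null set
  containing the origin.\<close>

lemma weak_partial_eq: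
  assumes u: "has_weak_partial stretch e u" and e: "e \<in> {1, \<i>}"
  shows "AE z in lebesgue. u z = partial e z"
proof -
  define Q where "Q n = {box (Complex (1 / real (Suc n)) (- real n)) (Complex (real n) (real n)),
     box (Complex (- real n) (- real n)) (Complex (- 1 / real (Suc n)) (real n))}" for n
  have "AE z in lebesgue. \<forall>n. \<forall>X\<in>Q n. z \<in> X \<longrightarrow> u z = partial e z"
    unfolding AE_all_countable Q_def
    by (intro allI AE_ball_countable' ballI) (auto intro!: weak_partial_eq_on_box[OF u e])
  moreover have "AE z::complex in lebesgue. Re z \<noteq> 0"
  proof (rule AE_not_in[where N="{z. Re z = 0}", simplified])
    have "negligible {z::complex. 1 \<bullet> z = 0}" by (rule negligible_hyperplane) simp
    then show "{z::complex. Re z = 0} \<in> null_sets lebesgue" by (simp add: negligible_iff_null_sets inner_complex_def)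
  qed
  ultimately show ?thesis
  proof eventually_elim
    case (elim z)
    obtain n1 where n1: "1 / real (Suc n1) < \<bar>Re z\<bar>"
      using reals_Archimedean[of "\<bar>Re z\<bar>"] elim(2) by (auto simp: inverse_eq_divide)
    obtain n2 :: nat where n2: "norm z < real n2" using reals_Archimedean2 by blast
    define n where "n = max n1 n2"
    have "1 / real (Suc n) \<le> 1 / real (Suc n1)" by (auto simp: n_def frac_le)
    then have 1: "1 / real (Suc n) < \<bar>Re z\<bar>" using n1 by linarith
    have "real n2 \<le> real n" by (simp add: n_def)
    then have 2: "\<bar>Re z\<bar> < real n" "\<bar>Im z\<bar> < real n"
      using n2 abs_Re_le_cmod[of z] abs_Im_le_cmod[of z] by linarith+
    have "\<exists>X\<in>Q n. z \<in> X"
      using 1 2 by (cases "0 < Re z") (auto simp: Q_def in_box_complex_iff abs_less_iff)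
    then show ?case using elim(1) by blast
  qed
qed

text \<open>The algebra behind the moduli \<open>\<bar>t + s\<bar> / 2\<close> and \<open>\<bar>t - s\<bar> / 2\<close>: in the two combinations of the partial
  derivatives the unit vector \<open>\<omega>\<close> enters as \<open>\<omega> * cnj \<omega> = 1\<close> and as \<open>\<omega>\<^sup>2\<close>.\<close>

lemma weak_d_dbar_eq:
  assumes d: "has_weak_d stretch df" and dbar: "has_weak_dbar stretch dbarf"
  shows "AE z in lebesgue. z \<noteq> 0 \<longrightarrow>
      df z = of_real ((slope (norm z) + g (norm z) / norm z) / 2) \<and>
      dbarf z = (sgn z)\<^sup>2 * of_real ((slope (norm z) - g (norm z) / norm z) / 2)"
proof -
  obtain fx fy where 1: "has_weak_partial stretch 1 fx" "has_weak_partial stretch \<i> fy" "df = (\<lambda>z. (fx z - \<i> * fy z) / 2)"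
    using d by (auto simp: has_weak_d_def)
  obtain gx gy where 2: "has_weak_partial stretch 1 gx" "has_weak_partial stretch \<i> gy" "dbarf = (\<lambda>z. (gx z + \<i> * gy z) / 2)"
    using dbar by (auto simp: has_weak_dbar_def)
  have "AE z in lebesgue. fx z = partial 1 z" "AE z in lebesgue. gx z = partial 1 z"
     "AE z in lebesgue. fy z = partial \<i> z" "AE z in lebesgue. gy z = partial \<i> z"
    using weak_partial_eq 1 2 by auto
  then show ?thesis
  proof eventually_elim
    case (elim z)
    show ?case
    proof
      assume "z \<noteq> 0"
      define \<omega> where "\<omega> = sgn z"
      define t where "t = slope (norm z)"
      define s where "s = g (norm z) / norm z"
      have "norm \<omega> = 1" using \<open>z \<noteq> 0\<close> by (simp add: \<omega>_def norm_sgn)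
      then have \<omega>: "\<omega> * cnj \<omega> = 1" using complex_norm_square[of \<omega>] by simp
      have p1: "partial 1 z = of_real ((t - s) * Re \<omega>) * \<omega> + of_real s"
       and pi: "partial \<i> z = of_real ((t - s) * Im \<omega>) * \<omega> + of_real s * \<i>"
        by (simp_all add: partial_def \<omega>_def[symmetric] t_def[symmetric] s_def[symmetric] inner_complex_def algebra_simps)
      have "partial 1 z - \<i> * partial \<i> z = of_real (t - s) * (\<omega> * (of_real (Re \<omega>) - \<i> * of_real (Im \<omega>))) + 2 * of_real s"
        unfolding p1 pi by (simp add: algebra_simps)
      also have "of_real (Re \<omega>) - \<i> * of_real (Im \<omega>) = cnj \<omega>" by (simp add: complex_eq_iff)
      finally have d: "partial 1 z - \<i> * partial \<i> z = of_real (t + s)" by (simp add: \<omega>)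
      have "partial 1 z + \<i> * partial \<i> z = of_real (t - s) * (\<omega> * (of_real (Re \<omega>) + \<i> * of_real (Im \<omega>)))"
        unfolding p1 pi by (simp add: algebra_simps)
      also have "of_real (Re \<omega>) + \<i> * of_real (Im \<omega>) = \<omega>" by (simp add: complex_eq_iff)
      finally have db: "partial 1 z + \<i> * partial \<i> z = of_real (t - s) * \<omega>\<^sup>2" by (simp add: power2_eq_square)
      show "df z = of_real ((slope (norm z) + g (norm z) / norm z) / 2) \<and>
          dbarf z = (sgn z)\<^sup>2 * of_real ((slope (norm z) - g (norm z) / norm z) / 2)"
        using d db elim by (simp add: 1(3) 2(3) \<omega>_def t_def s_def)
    qed
  qed
qed

end

lemma stretch_functions_profile:
  assumes "f \<in> stretch_functions"
  obtains g where "stretch_profile g" "f = stretch_profile.stretch g"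
proof -
  obtain g :: "real \<Rightarrow> real" where g: "\<And>r. 0 < r \<Longrightarrow> 0 \<le> g r"
      "\<And>r. 0 < r \<Longrightarrow> \<exists>\<epsilon>>0. \<exists>C. C-lipschitz_on (ball r \<epsilon> \<inter> {0<..}) g"
      "g 0 = 0" "(g \<longlongrightarrow> 0) (at_right 0)" "\<And>r \<theta>. 0 \<le> r \<Longrightarrow> f (rcis r \<theta>) = rcis (g r) \<theta>"
    using assms unfolding stretch_functions_def by blast
  define h where "h r = (if 0 < r then g r else 0)" for r
  have h: "stretch_profile h"
  proof
    show "0 \<le> h r" for r using g(1) by (simp add: h_def)
    show "h r = 0" if "r \<le> 0" for r using that by (simp add: h_def)
    show "(h \<longlongrightarrow> 0) (at_right 0)"
      by (rule Lim_transform_eventually[OF g(4)]) (auto simp: eventually_at_filter h_def)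
    show "\<exists>\<epsilon>>0. \<exists>C. C-lipschitz_on (ball r \<epsilon> \<inter> {0<..}) h" if r: "0 < r" for r
    proof -
      obtain \<epsilon> C where *: "\<epsilon> > 0" "C-lipschitz_on (ball r \<epsilon> \<inter> {0<..}) g" using g(2)[OF r] by blast
      have "C-lipschitz_on (ball r \<epsilon> \<inter> {0<..}) h"
        using *(2) by (rule lipschitz_on_transform) (use h_def in auto)
      with *(1) show ?thesis by blast
    qed
  qed
  have "f z = stretch_profile.stretch h z" for z
  proof -
    have "f z = f (rcis (norm z) (Arg z))" by (simp add: rcis_cmod_Arg)
    also have "\<dots> = rcis (g (norm z)) (Arg z)" by (rule g(5)) simp
    also have "\<dots> = of_real (h (norm z)) * sgn z"
      using g(3) by (cases "z = 0") (auto simp: h_def rcis_def cis_Arg)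
    finally show ?thesis by (simp add: stretch_profile.stretch_def[OF h])
  qed
  then show thesis using h by (intro that) auto
qed

section \<open>Null Lagrangians on stretch functions\<close>

lemma lipschitz_on_mult_bounded:
  fixes f h :: "'a::metric_space \<Rightarrow> real"
  assumes f: "C-lipschitz_on X f" "\<And>x. x \<in> X \<Longrightarrow> \<bar>f x\<bar> \<le> M"
    and h: "D-lipschitz_on X h" "\<And>x. x \<in> X \<Longrightarrow> \<bar>h x\<bar> \<le> N"
    and MN: "0 \<le> M" "0 \<le> N"
  shows "(M * D + N * C)-lipschitz_on X (\<lambda>x. f x * h x)"
proof (rule lipschitz_onI)
  have CD: "0 \<le> C" "0 \<le> D" using f h lipschitz_on_nonneg by blast+
  then show "0 \<le> M * D + N * C" using MN by simp
  fix x y assume xy: "x \<in> X" "y \<in> X"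
  have "f x * h x - f y * h y = f x * (h x - h y) + h y * (f x - f y)" by (simp add: algebra_simps)
  also have "\<bar>\<dots>\<bar> \<le> M * (D * dist x y) + N * (C * dist x y)"
    using f(2)[OF xy(1)] h(2)[OF xy(2)] lipschitz_onD[OF f(1) xy] lipschitz_onD[OF h(1) xy] CD MN
    by (intro order_trans[OF abs_triangle_ineq] add_mono) (auto simp: abs_mult dist_real_def intro!: mult_mono)
  finally show "dist (f x * h x) (f y * h y) \<le> (M * D + N * C) * dist x y"
    by (simp add: dist_real_def algebra_simps)
qed

lemma C1_imp_lipschitz_Icc:
  fixes k :: "real \<Rightarrow> real"
  assumes k: "\<And>x. x \<in> {a..b} \<Longrightarrow> (k has_real_derivative k' x) (at x within {a..b})"
    and k': "continuous_on {a..b} k'"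
  obtains C where "C-lipschitz_on {a..b} k"
proof -
  have "bounded (k' ` {a..b})" using k' by (intro compact_imp_bounded compact_continuous_image) auto
  then obtain C where C: "\<forall>y\<in>k' ` {a..b}. norm y \<le> C" unfolding bounded_iff by blast
  have "(max 0 C)-lipschitz_on {a..b} k"
  proof (rule bounded_derivative_imp_lipschitz)
    show "(k has_derivative (*) (k' x)) (at x within {a..b})" if "x \<in> {a..b}" for x
      using k[OF that] by (simp add: has_field_derivative_def)
    show "onorm ((*) (k' x)) \<le> max 0 C" if "x \<in> {a..b}" for x
    proof (rule onorm_bound)
      have "\<bar>k' x\<bar> \<le> max 0 C" using C that by force
      then show "norm (k' x * y) \<le> max 0 C * norm y" for y by (simp add: abs_mult mult_right_mono)
    qed simp
  qed auto
  then show thesis by (rule that)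
qed

text \<open>The integral of a difference quotient is a difference of short averages near the two endpoints; only
  continuity of \<open>H\<close> enters. Together with dominated convergence this is the fundamental theorem of
  calculus for functions that are merely Lipschitz.\<close>

lemma integral_difference_quotient_LIMSEQ:
  fixes H :: "real \<Rightarrow> real"
  assumes H: "continuous_on {0<..} H" and ab: "0 < a" "a \<le> b"
    and \<epsilon>: "filterlim \<epsilon> (at 0) sequentially" "\<And>n. 0 < \<epsilon> n" "\<And>n. \<epsilon> n \<le> 1"
  shows "(\<lambda>n. \<integral>r. (H (r + \<epsilon> n) - H r) / \<epsilon> n * indicator {a..b} r \<partial>lborel) \<longlonglongrightarrow> H b - H a"
proof -
  define A where "A x = integral {a/2..x} H" for x
  have A: "(A has_real_derivative H x) (at x)" if "x \<in> {a/2<..<b+2}" for x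
  proof -
    have "(A has_real_derivative H x) (at x within {a/2..b+2})"
      unfolding A_def[abs_def] using that ab
      by (intro integral_has_real_derivative continuous_on_subset[OF H]) auto
    then show ?thesis using that by (simp add: at_within_Icc_at)
  qed
  have lim: "(\<lambda>n. (A (x + \<epsilon> n) - A x) / \<epsilon> n) \<longlonglongrightarrow> H x" if "x \<in> {a..b}" for x
  proof -
    have "(A has_derivative (*) (H x)) (at x)"
      using A[of x] that ab by (simp add: has_field_derivative_def)
    from directional_LIMSEQ[OF this \<epsilon>(1), of 1] show ?thesis by (simp add: divide_inverse mult.commute)
  qed
  have "(\<integral>r. (H (r + \<epsilon> n) - H r) / \<epsilon> n * indicator {a..b} r \<partial>lborel)
      = (A (b + \<epsilon> n) - A b) / \<epsilon> n - (A (a + \<epsilon> n) - A a) / \<epsilon> n" for n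
  proof (rule integral_FTC_Icc_real)
    fix x assume x: "a \<le> x" "x \<le> b"
    have "((\<lambda>x. A (x + \<epsilon> n)) has_real_derivative H (x + \<epsilon> n)) (at x)"
      using A[of "x + \<epsilon> n"] x ab \<epsilon>(2)[of n] \<epsilon>(3)[of n] by (simp add: DERIV_shift)
    moreover have "(A has_real_derivative H x) (at x)" using A x ab by auto
    ultimately show "((\<lambda>x. (A (x + \<epsilon> n) - A x) / \<epsilon> n) has_real_derivative (H (x + \<epsilon> n) - H x) / \<epsilon> n) (at x)"
      by (intro DERIV_cdivide DERIV_diff)
    have "isCont H y" if "0 < y" for y
      using H that by (simp add: continuous_on_eq_continuous_at)
    then have "isCont H x" "isCont H (x + \<epsilon> n)" using x ab \<epsilon>(2)[of n] by auto
    then have "isCont (\<lambda>x. H (x + \<epsilon> n)) x"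
      using isCont_o2[of x "\<lambda>x. x + \<epsilon> n" H] by simp
    then show "isCont (\<lambda>x. (H (x + \<epsilon> n) - H x) / \<epsilon> n) x"
      using \<open>isCont H x\<close> \<epsilon>(2)[of n] by (intro continuous_divide continuous_diff continuous_const) auto
  qed (use ab in auto)
  moreover have "(\<lambda>n. (A (b + \<epsilon> n) - A b) / \<epsilon> n - (A (a + \<epsilon> n) - A a) / \<epsilon> n) \<longlonglongrightarrow> H b - H a"
    using ab by (intro tendsto_diff lim) auto
  ultimately show ?thesis by simp
qed

context stretch_profile
begin

lemma profile_ratio_nonneg: "0 \<le> g r / r"
  using nonneg[of r] nonpos[of r] by (cases "r \<le> 0") auto

lemma measurable_profile_ratio:
  fixes f :: "real \<Rightarrow> real"
  assumes f: "continuous_on {0..} f"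
  shows "(\<lambda>r. f (g r / r)) \<in> borel_measurable borel"
proof -
  have "continuous_on UNIV (\<lambda>x. f (max 0 x))"
    by (intro continuous_on_compose2[OF f] continuous_intros) auto
  then have [measurable]: "(\<lambda>x. f (max 0 x)) \<in> borel_measurable borel" by (rule borel_measurable_continuous_onI)
  have "(\<lambda>r. f (max 0 (g r / r))) \<in> borel_measurable borel" by measurable
  then show ?thesis using profile_ratio_nonneg by (simp add: max_absorb2)
qed

text \<open>With \<open>H r = r\<^sup>2 * k (g r / r)\<close> one has \<open>H' r / r = 2 * k s - s * k' s + k' s * g' r\<close> at every point of
  differentiability, and the integral of \<open>H' \<bar>z\<bar> / \<bar>z\<bar>\<close> over the annulus is the difference of boundary
  values of \<open>2 * pi * H\<close>. It is computed as the limit of the integrals of difference quotients of \<open>H\<close>,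
  which are bounded because \<open>H\<close> is Lipschitz on compact subintervals of the positive half-line.\<close>

lemma null_lagrangian_annulus:
  fixes k k' :: "real \<Rightarrow> real" and \<Psi> :: "complex \<Rightarrow> real"
  assumes k: "\<And>s. 0 \<le> s \<Longrightarrow> (k has_real_derivative k' s) (at s within {0..})"
    and k': "continuous_on {0..} k'"
    and int: "integrable lebesgue \<Psi>"
    and le: "AE z in lebesgue. z \<noteq> 0 \<longrightarrow>
       2 * k (g (norm z) / norm z) - (g (norm z) / norm z) * k' (g (norm z) / norm z)
         + k' (g (norm z) / norm z) * slope (norm z) \<le> \<Psi> z"
    and ab: "0 < a" "a \<le> b"
  shows "2 * pi * (b\<^sup>2 * k (g b / b) - a\<^sup>2 * k (g a / a))
      \<le> (LINT z|lebesgue. indicator {z. norm z \<in> {a..b}} z * \<Psi> z)"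
proof -
  define s where "s r = g r / r" for r
  define H where "H r = r\<^sup>2 * k (s r)" for r
  define D where "D r = r * (2 * k (s r) - s r * k' (s r) + k' (s r) * slope r)" for r
  define \<epsilon> where "\<epsilon> n = 1 / real (Suc n)" for n
  have \<epsilon>: "filterlim \<epsilon> (at 0) sequentially" "\<And>n. 0 < \<epsilon> n" "\<And>n. \<epsilon> n \<le> 1"
    using LIMSEQ_inverse_real_of_nat by (auto simp: \<epsilon>_def[abs_def] filterlim_at inverse_eq_divide)
  have s0: "0 \<le> s r" for r unfolding s_def by (rule profile_ratio_nonneg)
  have cont_k: "continuous_on {0..} k"
    using k by (auto simp: continuous_on_eq_continuous_within intro: DERIV_continuous)
  have cont_s: "continuous_on {0<..} s"
    unfolding s_def by (intro continuous_intros continuous_on_subset[OF continuous_g]) auto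
  have cont_H: "continuous_on {0<..} H"
    unfolding H_def by (intro continuous_intros continuous_on_compose2[OF cont_k cont_s]) (use s0 in auto)
  have [measurable]: "s \<in> borel_measurable borel" unfolding s_def[abs_def] by measurable
  note [measurable] = measurable_profile_ratio[OF cont_k, folded s_def] measurable_profile_ratio[OF k', folded s_def]
  have [measurable]: "H \<in> borel_measurable borel" "D \<in> borel_measurable borel"
    unfolding H_def[abs_def] D_def[abs_def] by measurable
  have DH: "(H has_real_derivative D r) (at r)" if r: "0 < r" and g': "(g has_real_derivative slope r) (at r)" for r
  proof -
    have "((\<lambda>r. g r / r) has_real_derivative (slope r * r - g r) / r\<^sup>2) (at r)"
      by (rule DERIV_cong[OF DERIV_divide[OF g' DERIV_ident]]) (use r in \<open>auto simp: power2_eq_square\<close>)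
    then have ds: "(s has_real_derivative (slope r * r - g r) / r\<^sup>2) (at r within {0<..})"
      unfolding s_def by (rule DERIV_subset) simp
    have "(k has_real_derivative k' (s r)) (at (s r) within s ` {0<..})"
      using k[OF s0] by (rule DERIV_subset) (use s0 in auto)
    from DERIV_image_chain[OF this ds]
    have dk: "((\<lambda>r. k (s r)) has_real_derivative k' (s r) * ((slope r * r - g r) / r\<^sup>2)) (at r)"
      using r by (simp add: o_def at_within_open[of r "{0<..}"])
    show ?thesis unfolding H_def
      by (rule derivative_eq_intros dk refl)+
         (use r in \<open>simp add: D_def s_def field_simps power2_eq_square\<close>)
  qed
  obtain C where C: "C-lipschitz_on {a..b+1} H"
  proof -
    obtain Cg where Cg: "Cg-lipschitz_on {a..b+1} g" using lipschitz_Icc ab by blast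
    have bdd: "\<exists>M\<ge>0. \<forall>r\<in>{a..b+1}. \<bar>f r\<bar> \<le> M" if "continuous_on {0<..} f" for f :: "real \<Rightarrow> real"
    proof -
      have "bounded (f ` {a..b+1})"
        using ab by (intro compact_imp_bounded compact_continuous_image continuous_on_subset[OF that]) auto
      then obtain M where "\<forall>y\<in>f ` {a..b+1}. norm y \<le> M" unfolding bounded_iff by blast
      then show ?thesis by (intro exI[of _ "max 0 M"]) (auto simp: le_max_iff_disj)
    qed
    obtain Ci where Ci: "Ci-lipschitz_on {a..b+1} (\<lambda>r::real. inverse r)"
    proof (rule C1_imp_lipschitz_Icc)
      show "((\<lambda>r. inverse r) has_real_derivative - (inverse x ^ Suc (Suc 0))) (at x within {a..b+1})"
        if "x \<in> {a..b+1}" for x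
        using that ab by (intro DERIV_inverse) auto
    qed (use ab in \<open>auto intro!: continuous_intros\<close>)
    obtain Cq where Cq: "Cq-lipschitz_on {a..b+1} (\<lambda>r::real. r\<^sup>2)"
      by (rule C1_imp_lipschitz_Icc[of a "b+1" "\<lambda>r. r\<^sup>2" "\<lambda>r. 2 * r"])
         (auto intro!: derivative_eq_intros continuous_intros)
    have "continuous_on {0<..} g" using continuous_g by (rule continuous_on_subset) simp
    then obtain M1 where M1: "0 \<le> M1" "\<forall>r\<in>{a..b+1}. \<bar>g r\<bar> \<le> M1" using bdd by blast
    have "continuous_on {0<..} (\<lambda>r::real. inverse r)" by (intro continuous_intros) auto
    then obtain M2 where M2: "0 \<le> M2" "\<forall>r\<in>{a..b+1}. \<bar>inverse r\<bar> \<le> M2" using bdd by blast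
    obtain M3 where M3: "0 \<le> M3" "\<forall>r\<in>{a..b+1}. \<bar>s r\<bar> \<le> M3" using bdd[OF cont_s] by blast
    have "continuous_on {0<..} (\<lambda>r::real. r\<^sup>2)" by (intro continuous_intros)
    then obtain M4 where M4: "0 \<le> M4" "\<forall>r\<in>{a..b+1}. \<bar>r\<^sup>2\<bar> \<le> M4" using bdd by blast
    have "continuous_on {0<..} (\<lambda>r. k (s r))"
      by (intro continuous_on_compose2[OF cont_k cont_s]) (use s0 in auto)
    then obtain M5 where M5: "0 \<le> M5" "\<forall>r\<in>{a..b+1}. \<bar>k (s r)\<bar> \<le> M5" using bdd by blast
    note M = M1 M2 M3 M4 M5
    have "(M1 * Ci + M2 * Cg)-lipschitz_on {a..b+1} (\<lambda>r. g r * inverse r)"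
      using M by (intro lipschitz_on_mult_bounded Cg Ci) auto
    then have Cs: "(M1 * Ci + M2 * Cg)-lipschitz_on {a..b+1} s" by (simp add: s_def[abs_def] divide_inverse)
    obtain Ck where Ck: "Ck-lipschitz_on {0..M3} k"
    proof (rule C1_imp_lipschitz_Icc)
      show "(k has_real_derivative k' x) (at x within {0..M3})" if "x \<in> {0..M3}" for x
        by (rule DERIV_subset[OF k]) (use that in auto)
      show "continuous_on {0..M3} k'" using k' by (rule continuous_on_subset) auto
    qed
    have "s ` {a..b+1} \<subseteq> {0..M3}" using M(6) s0 by fastforce
    then have "(Ck * (M1 * Ci + M2 * Cg))-lipschitz_on {a..b+1} (\<lambda>r. k (s r))"
      using Cs Ck by (intro lipschitz_on_compose2 lipschitz_on_subset[OF Ck])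
    then have "(M4 * (Ck * (M1 * Ci + M2 * Cg)) + M5 * Cq)-lipschitz_on {a..b+1} H"
      unfolding H_def using M by (intro lipschitz_on_mult_bounded Cq) auto
    then show thesis by (rule that)
  qed
  \<comment> \<open>The division by \<open>r\<close> cancels the density \<open>2 * pi * r\<close> of polar coordinates.\<close>
  define q where "q n r = indicator {a..b} r * ((H (r + \<epsilon> n) - H r) / \<epsilon> n) / r" for n r
  have D_meas: "(\<lambda>z. indicator {a..b} (norm (z::complex)) * D (norm z) / norm z) \<in> borel_measurable lborel"
    by measurable
  have q_meas: "(\<lambda>z::complex. q n (norm z)) \<in> borel_measurable lborel" for n unfolding q_def by measurable
  have q_bound_int: "integrable lborel (\<lambda>z. indicator (cball (0::complex) b) z *\<^sub>R (C / a))"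
    by (rule borel_integrable_compact) auto
  have q_lim: "AE z in lborel. (\<lambda>n. q n (norm (z::complex))) \<longlonglongrightarrow> indicator {a..b} (norm z) * D (norm z) / norm z"
    using AE_differentiable_norm
  proof eventually_elim
    case (elim z)
    show ?case
    proof (cases "z = 0")
      case False
      have "(H has_derivative (*) (D (norm z))) (at (norm z))"
        using DH[of "norm z"] elim False by (simp add: has_field_derivative_def)
      from directional_LIMSEQ[OF this \<epsilon>(1), of 1]
      have "(\<lambda>n. (H (norm z + \<epsilon> n) - H (norm z)) / \<epsilon> n) \<longlonglongrightarrow> D (norm z)"
        by (simp add: divide_inverse mult.commute)
      then show ?thesis unfolding q_def using False by (intro tendsto_intros) auto
    qed (simp add: q_def)
  qed
  have q_bound: "AE z in lborel. norm (q n (norm (z::complex))) \<le> indicator (cball (0::complex) b) z *\<^sub>R (C / a)" for n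
  proof (rule AE_I2)
    fix z :: complex
    show "norm (q n (norm z)) \<le> indicator (cball (0::complex) b) z *\<^sub>R (C / a)"
    proof (cases "norm z \<in> {a..b}")
      case True
      have "\<bar>H (norm z + \<epsilon> n) - H (norm z)\<bar> \<le> C * \<epsilon> n"
        using lipschitz_onD[OF C, of "norm z + \<epsilon> n" "norm z"] True \<epsilon>(2)[of n] \<epsilon>(3)[of n]
        by (auto simp: dist_real_def)
      then have "\<bar>(H (norm z + \<epsilon> n) - H (norm z)) / \<epsilon> n\<bar> \<le> C" using \<epsilon>(2)[of n] by (simp add: abs_divide divide_simps)
      then have "\<bar>(H (norm z + \<epsilon> n) - H (norm z)) / \<epsilon> n\<bar> / norm z \<le> C / a"
        using True ab lipschitz_on_nonneg[OF C] by (intro frac_le) auto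
      then show ?thesis using True by (simp add: q_def abs_divide abs_mult)
    next
      case False
      then show ?thesis using lipschitz_on_nonneg[OF C] ab by (auto simp: q_def indicator_def)
    qed
  qed
  note dom = D_meas q_meas q_bound_int q_lim q_bound
  have int1: "integrable lborel (\<lambda>z. indicator {a..b} (norm (z::complex)) * D (norm z) / norm z)"
    by (rule integrable_dominated_convergence[OF dom])
  have "(\<lambda>n. \<integral>z. q n (norm (z::complex)) \<partial>lborel) \<longlonglongrightarrow> (\<integral>z. indicator {a..b} (norm (z::complex)) * D (norm z) / norm z \<partial>lborel)"
    by (rule integral_dominated_convergence[OF dom])
  moreover have "(\<integral>z. q n (norm (z::complex)) \<partial>lborel) = 2 * pi * (\<integral>r. (H (r + \<epsilon> n) - H r) / \<epsilon> n * indicator {a..b} r \<partial>lborel)" for n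
  proof -
    have "(\<integral>z. q n (norm (z::complex)) \<partial>lborel) = (\<integral>r. (2 * pi * r) * indicator {0<..} r * q n r \<partial>lborel)"
      by (rule integral_radial_complex) (simp add: q_def)
    also have "\<dots> = (\<integral>r. 2 * pi * ((H (r + \<epsilon> n) - H r) / \<epsilon> n * indicator {a..b} r) \<partial>lborel)"
      by (intro Bochner_Integration.integral_cong refl) (use ab in \<open>auto simp: q_def indicator_def\<close>)
    finally show ?thesis by simp
  qed
  moreover have "(\<lambda>n. 2 * pi * (\<integral>r. (H (r + \<epsilon> n) - H r) / \<epsilon> n * indicator {a..b} r \<partial>lborel)) \<longlonglongrightarrow> 2 * pi * (H b - H a)"
    by (intro tendsto_mult tendsto_const integral_difference_quotient_LIMSEQ cont_H ab \<epsilon>)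
  ultimately have eq: "(\<integral>z. indicator {a..b} (norm (z::complex)) * D (norm z) / norm z \<partial>lborel) = 2 * pi * (H b - H a)"
    using LIMSEQ_unique by simp
  have "2 * pi * (H b - H a) = (LINT z|lebesgue. indicator {a..b} (norm (z::complex)) * D (norm z) / norm z)"
    unfolding eq[symmetric] by (rule integral_completion[symmetric]) (use D_meas in simp)
  also have "\<dots> \<le> (LINT z|lebesgue. indicator {z. norm z \<in> {a..b}} z * \<Psi> z)"
  proof (rule integral_mono_AE)
    show "integrable lebesgue (\<lambda>z::complex. indicator {a..b} (norm z) * D (norm z) / norm z)"
      using int1 D_meas by (subst integrable_completion) auto
    have "{z::complex. norm z \<in> {a..b}} \<in> sets borel" by measurable
    then have "{z::complex. norm z \<in> {a..b}} \<in> sets lebesgue" by simp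
    from integrable_mult_indicator[OF this int]
    show "integrable lebesgue (\<lambda>z. indicator {z. norm z \<in> {a..b}} z * \<Psi> z)" by simp
    show "AE z in lebesgue. indicator {a..b} (norm z) * D (norm z) / norm z
        \<le> indicator {z. norm z \<in> {a..b}} z * \<Psi> z"
      using le
    proof eventually_elim
      case (elim z)
      show ?case
      proof (cases "norm z \<in> {a..b}")
        case True
        then have "0 < norm z" using ab by auto
        then show ?thesis using elim True by (simp add: D_def s_def)
      next
        case False
        then have "indicat_real {z. norm z \<in> {a..b}} z = 0" "indicat_real {a..b} (norm z) = 0"
          by (simp_all add: indicator_def)
        then show ?thesis by simp
      qed
    qed
  qed
  finally show ?thesis by (simp add: H_def s_def)
qed

text \<open>Suppose the integral is negative. Since \<open>H b \<ge> 0\<close>, the annulus bound then keeps \<open>H a\<close> above some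
  \<open>\<delta> > 0\<close> for all small \<open>a\<close>. So \<open>k (g \<bar>z\<bar> / \<bar>z\<bar>) = H \<bar>z\<bar> / \<bar>z\<bar>\<^sup>2\<close> dominates \<open>\<delta> / \<bar>z\<bar>\<^sup>2\<close> near the origin, and its
  integral exceeds every multiple of a divergent logarithm, contrary to integrability.\<close>

lemma null_lagrangian_integral_nonneg:
  fixes k k' :: "real \<Rightarrow> real" and \<Psi> :: "complex \<Rightarrow> real"
  assumes k: "\<And>s. 0 \<le> s \<Longrightarrow> (k has_real_derivative k' s) (at s within {0..})"
    and k': "continuous_on {0..} k'"
    and k0: "\<And>s. 0 \<le> s \<Longrightarrow> 0 \<le> k s"
    and int: "integrable lebesgue \<Psi>"
    and int_k: "integrable lebesgue (\<lambda>z. k (g (norm z) / norm (z::complex)))"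
    and le: "AE z in lebesgue. z \<noteq> 0 \<longrightarrow>
       2 * k (g (norm z) / norm z) - (g (norm z) / norm z) * k' (g (norm z) / norm z)
         + k' (g (norm z) / norm z) * slope (norm z) \<le> \<Psi> z"
  shows "0 \<le> (LINT z|lebesgue. \<Psi> z)"
proof (rule ccontr)
  define H where "H r = r\<^sup>2 * k (g r / r)" for r
  define I where "I = (LINT z|lebesgue. \<Psi> z)"
  define A where "A a b = {z::complex. norm z \<in> {a..b}}" for a b
  assume "\<not> 0 \<le> (LINT z|lebesgue. \<Psi> z)"
  then have I: "I < 0" by (simp add: I_def)
  have [measurable]: "\<Psi> \<in> borel_measurable lebesgue" using int by (rule borel_measurable_integrable)
  have A_sets: "A a b \<in> sets lebesgue" for a b
  proof -
    have "A a b \<in> sets borel" unfolding A_def by measurable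
    then show ?thesis by simp
  qed
  have A_compl: "- A a b \<in> sets lebesgue" for a b
    using A_sets[of a b] by (simp only: Compl_in_sets_lebesgue)
  have H0: "0 \<le> H r" for r
    unfolding H_def using k0 profile_ratio_nonneg by (intro mult_nonneg_nonneg) auto
  have annulus: "2 * pi * (H b - H a) \<le> (LINT z|lebesgue. indicator (A a b) z * \<Psi> z)" if "0 < a" "a \<le> b" for a b
    unfolding H_def A_def using null_lagrangian_annulus[OF k k' int le that] by simp
  have A_ge: "indicat_real (- A (1 / real (Suc n)) (real (Suc n))) z = 0"
    if "1 / real (Suc m) < norm z" "norm z < real (Suc m)" "m \<le> n" for z m n
  proof -
    have "1 / real (Suc n) \<le> 1 / real (Suc m)" using that(3) by (intro frac_le) auto
    then show ?thesis using that by (auto simp: A_def)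
  qed
  have "(\<lambda>n. LINT z|lebesgue. indicator (- A (1 / real (Suc n)) (real (Suc n))) z * \<bar>\<Psi> z\<bar>)
      \<longlonglongrightarrow> (LINT z|(lebesgue :: complex measure). 0)"
  proof (rule integral_dominated_convergence[where w="\<lambda>z. \<bar>\<Psi> z\<bar>"])
    show "AE z in lebesgue. (\<lambda>n. indicator (- A (1 / real (Suc n)) (real (Suc n))) z * \<bar>\<Psi> z\<bar>) \<longlonglongrightarrow> 0"
      using AE_completion[OF AE_lborel_singleton[of 0]]
    proof eventually_elim
      case (elim z)
      obtain n1 where n1: "1 / real (Suc n1) < norm z"
        using reals_Archimedean[of "norm z"] elim by (auto simp: inverse_eq_divide)
      obtain n2 :: nat where n2: "norm z < real n2" using reals_Archimedean2 by blast
      define m where "m = max n1 n2"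
      have "1 / real (Suc m) \<le> 1 / real (Suc n1)" by (intro frac_le) (auto simp: m_def)
      then have m: "1 / real (Suc m) < norm z" "norm z < real (Suc m)" using n1 n2 by (auto simp: m_def)
      have "\<forall>\<^sub>F n in sequentially. indicator (- A (1 / real (Suc n)) (real (Suc n))) z * \<bar>\<Psi> z\<bar> = 0"
        using eventually_ge_at_top[of m] by eventually_elim (use A_ge[OF m] in simp)
      then show ?case by (rule tendsto_eventually)
    qed
    show "(\<lambda>z. indicat_real (- A (1 / real (Suc n)) (real (Suc n))) z * \<bar>\<Psi> z\<bar>) \<in> borel_measurable lebesgue" for n
      by (intro borel_measurable_times borel_measurable_indicator A_compl) auto
  qed (use int in \<open>auto simp: abs_mult indicator_def\<close>)
  then have "\<forall>\<^sub>F n in sequentially. (LINT z|lebesgue. indicator (- A (1 / real (Suc n)) (real (Suc n))) z * \<bar>\<Psi> z\<bar>) < - I / 2"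
    by (rule order_tendstoD(2)) (use I in simp)
  then obtain N where N: "(LINT z|lebesgue. indicator (- A (1 / real (Suc N)) (real (Suc N))) z * \<bar>\<Psi> z\<bar>) < - I / 2"
    by (auto simp: eventually_sequentially)
  \<comment> \<open>Outside the annulus \<open>A \<eta> b\<close> the function \<open>\<Psi>\<close> has less than half of the mass \<open>- I\<close>; the same holds for each larger annulus \<open>A a b\<close>.\<close>
  define \<eta> where "\<eta> = 1 / real (Suc N)"
  define b where "b = real (Suc N)"
  define \<delta> where "\<delta> = - I / (4 * pi)"
  have \<eta>: "0 < \<eta>" "\<eta> \<le> b" by (auto simp: \<eta>_def b_def divide_le_eq_1 intro: order_trans[of _ 1])
  have \<delta>: "0 < \<delta>" using I by (simp add: \<delta>_def divide_neg_pos)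
  have mult_int: "integrable lebesgue (\<lambda>z. indicator B z * f z)"
    if "B \<in> sets lebesgue" "integrable lebesgue f" for B and f :: "complex \<Rightarrow> real"
    using integrable_mult_indicator[OF that] by simp
  have H_ge: "\<delta> \<le> H a" if a: "0 < a" "a \<le> \<eta>" for a
  proof -
    have ints: "integrable lebesgue (\<lambda>z. indicator (A a b) z * \<Psi> z)" "integrable lebesgue (\<lambda>z. indicator (- A a b) z * \<Psi> z)"
        "integrable lebesgue (\<lambda>z. indicator (- A \<eta> b) z * \<bar>\<Psi> z\<bar>)"
      using int by (intro mult_int A_sets A_compl integrable_abs; assumption)+
    have "I = (LINT z|lebesgue. indicator (A a b) z * \<Psi> z + indicator (- A a b) z * \<Psi> z)"
      unfolding I_def by (intro Bochner_Integration.integral_cong) (auto simp: indicator_def)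
    also have "\<dots> = (LINT z|lebesgue. indicator (A a b) z * \<Psi> z) + (LINT z|lebesgue. indicator (- A a b) z * \<Psi> z)"
      using ints by (intro Bochner_Integration.integral_add)
    finally have split: "I = \<dots>" .
    have "- (LINT z|lebesgue. indicator (- A a b) z * \<Psi> z) = (LINT z|lebesgue. - (indicator (- A a b) z * \<Psi> z))" by simp
    also have "\<dots> \<le> (LINT z|lebesgue. indicator (- A \<eta> b) z * \<bar>\<Psi> z\<bar>)"
    proof (rule integral_mono)
      show "- (indicator (- A a b) z * \<Psi> z) \<le> indicator (- A \<eta> b) z * \<bar>\<Psi> z\<bar>" for z
        using a by (auto simp: indicator_def A_def)
    qed (use ints in auto)
    also have "\<dots> < - I / 2" using N by (simp add: \<eta>_def b_def)
    finally have "(LINT z|lebesgue. indicator (A a b) z * \<Psi> z) < I / 2" using split by simp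
    moreover have "2 * pi * (H b - H a) \<le> (LINT z|lebesgue. indicator (A a b) z * \<Psi> z)"
      using a \<eta> by (intro annulus) auto
    moreover have "- (2 * pi * H a) \<le> 2 * pi * (H b - H a)" using H0[of b] by (simp add: algebra_simps)
    ultimately have "- (2 * pi * H a) \<le> I / 2" by linarith
    then show ?thesis by (simp add: \<delta>_def field_simps)
  qed
  define J where "J = (LINT z|lebesgue. k (g (norm z) / norm (z::complex)))"
  have J_ge: "2 * pi * \<delta> * (ln \<eta> - ln a) \<le> J" if a: "0 < a" "a \<le> \<eta>" for a
  proof -
    define h where "h r = indicator {a..\<eta>} r * (\<delta> / r\<^sup>2)" for r :: real
    have [measurable]: "h \<in> borel_measurable borel" unfolding h_def by measurable
    have "(\<integral>z. h (norm (z::complex)) \<partial>lborel) = (\<integral>r. (2 * pi * r) * indicator {0<..} r * h r \<partial>lborel)"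
      by (rule integral_radial_complex) measurable
    also have "\<dots> = (\<integral>r. (2 * pi * \<delta> / r) * indicator {a..\<eta>} r \<partial>lborel)"
      by (intro Bochner_Integration.integral_cong refl)
         (use a in \<open>auto simp: h_def indicator_def power2_eq_square field_simps\<close>)
    also have "\<dots> = 2 * pi * \<delta> * ln \<eta> - 2 * pi * \<delta> * ln a"
      by (rule integral_FTC_Icc_real)
         (use a in \<open>auto intro!: derivative_eq_intros continuous_intros simp: field_simps\<close>)
    finally have eq: "(\<integral>z. h (norm (z::complex)) \<partial>lborel) = 2 * pi * \<delta> * (ln \<eta> - ln a)" by (simp add: algebra_simps)
    have h_le: "h (norm z) \<le> k (g (norm z) / norm z)" "0 \<le> h (norm z)" for z :: complex
    proof -
      show "0 \<le> h (norm z)" using \<delta> by (simp add: h_def)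
      show "h (norm z) \<le> k (g (norm z) / norm z)"
      proof (cases "norm z \<in> {a..\<eta>}")
        case True
        then have "0 < norm z" using a by auto
        then show ?thesis using H_ge[of "norm z"] True by (simp add: h_def H_def divide_le_eq mult.commute)
      next
        case False
        then show ?thesis using k0[OF profile_ratio_nonneg] by (simp add: h_def)
      qed
    qed
    have "(\<integral>z. h (norm (z::complex)) \<partial>lborel) = (LINT z|lebesgue. h (norm (z::complex)))"
      by (rule integral_completion[symmetric]) measurable
    also have "\<dots> \<le> J" unfolding J_def
    proof (rule integral_mono)
      show "integrable lebesgue (\<lambda>z::complex. h (norm z))"
      proof (rule Bochner_Integration.integrable_bound[OF int_k])
        have "(\<lambda>z::complex. h (norm z)) \<in> borel_measurable lborel" by measurable
        then show "(\<lambda>z::complex. h (norm z)) \<in> borel_measurable lebesgue" by (rule measurable_completion)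
        show "AE z in lebesgue. norm (h (norm z)) \<le> norm (k (g (norm z) / norm (z::complex)))"
        proof (rule AE_I2)
          fix z :: complex
          show "norm (h (norm z)) \<le> norm (k (g (norm z) / norm z))" using h_le[of z] by simp
        qed
      qed
    qed (use h_le int_k in auto)
    finally show ?thesis using eq by simp
  qed
  \<comment> \<open>Chosen so that the logarithmic lower bound for \<open>J\<close> exceeds \<open>J\<close>.\<close>
  define a where "a = \<eta> * exp (- (\<bar>J\<bar> + 1) / (2 * pi * \<delta>))"
  have "0 < a" "a \<le> \<eta>" using \<eta> \<delta> by (auto simp: a_def mult_le_cancel_left2 divide_nonpos_pos)
  moreover have "ln a = ln \<eta> - (\<bar>J\<bar> + 1) / (2 * pi * \<delta>)" using \<eta> by (simp add: a_def ln_mult minus_divide_left)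
  ultimately have "2 * pi * \<delta> * ((\<bar>J\<bar> + 1) / (2 * pi * \<delta>)) \<le> J" using J_ge[of a] by simp
  moreover have "2 * pi * \<delta> * ((\<bar>J\<bar> + 1) / (2 * pi * \<delta>)) = \<bar>J\<bar> + 1" using \<delta> by simp
  ultimately show False by simp
qed

end

lemma weak_partial_measurable:
  assumes "has_weak_partial f e u"
  shows "u \<in> borel_measurable lebesgue"
proof (rule borel_measurable_LIMSEQ_metric)
  have "set_integrable lebesgue (cball 0 (real n)) u" for n
    using assms compact_cball[of "0::complex" "real n"]
    unfolding has_weak_partial_def locally_integrable_def by blast
  then show "(\<lambda>z. indicator (cball 0 (real n)) z *\<^sub>R u z) \<in> borel_measurable lebesgue" for n
    by (auto simp: set_integrable_def)
  show "(\<lambda>n. indicator (cball 0 (real n)) z *\<^sub>R u z) \<longlonglongrightarrow> u z" for z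
  proof (rule tendsto_eventually)
    obtain m :: nat where m: "norm z < real m" using reals_Archimedean2 by blast
    show "\<forall>\<^sub>F n in sequentially. indicator (cball 0 (real n)) z *\<^sub>R u z = u z"
      using eventually_ge_at_top[of m]
    proof eventually_elim
      case (elim n)
      then have "z \<in> cball 0 (real n)" using m by auto
      then show ?case by simp
    qed
  qed
qed

lemma powr_add_le:
  fixes a b p :: real
  assumes "0 \<le> a" "0 \<le> b" "0 < p"
  shows "(a + b) powr p \<le> 2 powr p * (a powr p + b powr p)"
proof -
  have "(a + b) powr p \<le> (2 * max a b) powr p" using assms by (intro powr_mono2) auto
  also have "\<dots> = 2 powr p * max a b powr p" using assms by (intro powr_mult)
  also have "\<dots> \<le> 2 powr p * (a powr p + b powr p)"
    by (intro mult_left_mono) (auto simp: max_def)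
  finally show ?thesis .
qed

text \<open>The interface between analysis and pointwise inequalities. The growth bounds on \<open>\<Theta>\<close> and \<open>k\<close> turn the
  Sobolev condition into the two integrability requirements of the null Lagrangian argument; for \<open>k\<close>
  this uses that \<open>s \<le> max \<bar>t\<bar> s\<close>, the sum of the moduli of the two complex derivatives.\<close>

lemma (in stretch_profile) gradient_functional_nonneg:
  fixes \<Theta> :: "complex \<Rightarrow> complex \<Rightarrow> real" and k k' :: "real \<Rightarrow> real"
  assumes p: "0 < p" and sob: "stretch \<in> hom_sobolev p"
    and d: "has_weak_d stretch df" and dbar: "has_weak_dbar stretch dbarf"
    and k: "\<And>s. 0 \<le> s \<Longrightarrow> (k has_real_derivative k' s) (at s within {0..})"
    and k': "continuous_on {0..} k'"
    and k_bound: "\<And>s. 0 \<le> s \<Longrightarrow> 0 \<le> k s \<and> k s \<le> C * s powr p"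
    and meas: "df \<in> borel_measurable lebesgue \<Longrightarrow> dbarf \<in> borel_measurable lebesgue \<Longrightarrow>
        (\<lambda>z. \<Theta> (df z) (dbarf z)) \<in> borel_measurable lebesgue"
    and \<Theta>_bound: "\<And>z w. \<bar>\<Theta> z w\<bar> \<le> B * (norm z + norm w) powr p"
    and le: "\<And>s t z w. 0 \<le> s \<Longrightarrow> norm z = \<bar>t + s\<bar> / 2 \<Longrightarrow> norm w = \<bar>t - s\<bar> / 2 \<Longrightarrow>
        2 * k s - s * k' s + k' s * t \<le> \<Theta> z w"
  shows "integrable lebesgue (\<lambda>z. \<Theta> (df z) (dbarf z))"
    and "0 \<le> (LINT z|lebesgue. \<Theta> (df z) (dbarf z))"
proof -
  obtain fx fy where xy: "has_weak_partial stretch 1 fx" "has_weak_partial stretch \<i> fy" "fx \<in> Lp p" "fy \<in> Lp p"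
    using sob by (auto simp: hom_sobolev_def)
  obtain fx1 fy1 where 1: "has_weak_partial stretch 1 fx1" "has_weak_partial stretch \<i> fy1" "df = (\<lambda>z. (fx1 z - \<i> * fy1 z) / 2)"
    using d by (auto simp: has_weak_d_def)
  obtain fx2 fy2 where 2: "has_weak_partial stretch 1 fx2" "has_weak_partial stretch \<i> fy2" "dbarf = (\<lambda>z. (fx2 z + \<i> * fy2 z) / 2)"
    using dbar by (auto simp: has_weak_dbar_def)
  have [measurable]: "df \<in> borel_measurable lebesgue" "dbarf \<in> borel_measurable lebesgue"
    unfolding 1(3) 2(3)
    using weak_partial_measurable[OF 1(1)] weak_partial_measurable[OF 1(2)]
      weak_partial_measurable[OF 2(1)] weak_partial_measurable[OF 2(2)] by measurable
  have meas_\<Theta>: "(\<lambda>z. \<Theta> (df z) (dbarf z)) \<in> borel_measurable lebesgue" by (rule meas) measurable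
  define W where "W z = 2 powr p * (norm (fx z) powr p + norm (fy z) powr p)" for z
  have W: "integrable lebesgue W" using xy(3,4) by (simp add: W_def[abs_def] Lp_def)
  have "AE z in lebesgue. fx z = partial 1 z" "AE z in lebesgue. fx1 z = partial 1 z" "AE z in lebesgue. fx2 z = partial 1 z"
     "AE z in lebesgue. fy z = partial \<i> z" "AE z in lebesgue. fy1 z = partial \<i> z" "AE z in lebesgue. fy2 z = partial \<i> z"
    using weak_partial_eq xy 1 2 by auto
  then have dW: "AE z in lebesgue. (norm (df z) + norm (dbarf z)) powr p \<le> W z"
  proof eventually_elim
    case (elim z)
    have "norm (fx z - \<i> * fy z) \<le> norm (fx z) + norm (fy z)" "norm (fx z + \<i> * fy z) \<le> norm (fx z) + norm (fy z)"
      using norm_triangle_ineq4[of "fx z" "\<i> * fy z"] norm_triangle_ineq[of "fx z" "\<i> * fy z"] by (auto simp: norm_mult)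
    then have "norm (df z) + norm (dbarf z) \<le> norm (fx z) + norm (fy z)"
      using elim by (simp add: 1(3) 2(3) norm_divide)
    then have "(norm (df z) + norm (dbarf z)) powr p \<le> (norm (fx z) + norm (fy z)) powr p"
      using p by (intro powr_mono2) auto
    also have "\<dots> \<le> W z" unfolding W_def using p by (intro powr_add_le) auto
    finally show ?case .
  qed
  \<comment> \<open>The bound at a single pair with nonzero norm sum already determines the sign.\<close>
  have B0: "0 \<le> B"
    using order_trans[OF abs_ge_zero \<Theta>_bound[of 1 0]] by simp
  show int: "integrable lebesgue (\<lambda>z. \<Theta> (df z) (dbarf z))"
  proof (rule Bochner_Integration.integrable_bound)
    show "integrable lebesgue (\<lambda>z. B * W z)" using W by simp
    show "AE z in lebesgue. norm (\<Theta> (df z) (dbarf z)) \<le> norm (B * W z)"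
      using dW
    proof eventually_elim
      case (elim z)
      have "\<bar>\<Theta> (df z) (dbarf z)\<bar> \<le> B * W z"
        by (rule order_trans[OF \<Theta>_bound mult_left_mono[OF elim B0]])
      then show ?case by simp
    qed
  qed (rule meas_\<Theta>)
  have nonzero: "AE z in lebesgue. z \<noteq> (0::complex)"
    by (rule AE_completion[OF AE_lborel_singleton])
  have cont_k: "continuous_on {0..} k"
    using k by (auto simp: continuous_on_eq_continuous_within intro: DERIV_continuous)
  have norms: "AE z in lebesgue. norm (df z) = \<bar>slope (norm z) + g (norm z) / norm z\<bar> / 2
      \<and> norm (dbarf z) = \<bar>slope (norm z) - g (norm z) / norm z\<bar> / 2"
    using weak_d_dbar_eq[OF d dbar] nonzero
  proof eventually_elim
    case (elim z)
    then have "norm (sgn z) = 1" by (simp add: norm_sgn)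
    moreover have df: "df z = of_real ((slope (norm z) + g (norm z) / norm z) / 2)"
      and dbarf: "dbarf z = (sgn z)\<^sup>2 * of_real ((slope (norm z) - g (norm z) / norm z) / 2)"
      using elim by blast+
    ultimately show ?case unfolding df dbarf norm_mult norm_power norm_of_real by simp
  qed
  show "0 \<le> (LINT z|lebesgue. \<Theta> (df z) (dbarf z))"
  proof (rule null_lagrangian_integral_nonneg[OF k k' _ int])
    show "0 \<le> k s" if "0 \<le> s" for s using k_bound that by blast
    show "integrable lebesgue (\<lambda>z. k (g (norm z) / norm (z::complex)))"
    proof (rule Bochner_Integration.integrable_bound)
      show "integrable lebesgue (\<lambda>z. C * W z)" using W by simp
      have [measurable]: "(\<lambda>r. k (g r / r)) \<in> borel_measurable borel" using cont_k by (rule measurable_profile_ratio)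
      have "(\<lambda>z::complex. k (g (norm z) / norm z)) \<in> borel_measurable lborel" by measurable
      then show "(\<lambda>z::complex. k (g (norm z) / norm z)) \<in> borel_measurable lebesgue" by (rule measurable_completion)
      have "0 \<le> C" using k_bound[of 1] by simp
      show "AE z in lebesgue. norm (k (g (norm z) / norm z)) \<le> norm (C * W z)"
        using norms dW
      proof eventually_elim
        case (elim z)
        define s where "s = g (norm z) / norm z"
        have s: "0 \<le> s" unfolding s_def by (rule profile_ratio_nonneg)
        have "s \<le> norm (df z) + norm (dbarf z)" using elim(1) unfolding s_def[symmetric] by auto
        then have "s powr p \<le> (norm (df z) + norm (dbarf z)) powr p" using s p by (intro powr_mono2) auto
        then have "C * s powr p \<le> C * W z" using elim(2) \<open>0 \<le> C\<close> by (intro mult_left_mono) auto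
        then have "0 \<le> k s" "k s \<le> C * W z" using k_bound[OF s] by auto
        then show ?case unfolding s_def[symmetric] by simp
      qed
    qed
    show "AE z in lebesgue. z \<noteq> 0 \<longrightarrow>
       2 * k (g (norm z) / norm z) - (g (norm z) / norm z) * k' (g (norm z) / norm z)
         + k' (g (norm z) / norm z) * slope (norm z) \<le> \<Theta> (df z) (dbarf z)"
      using norms by eventually_elim (intro impI le profile_ratio_nonneg; simp)
  qed
qed

section \<open>The integrand L\<close>

lemma L_fun_bound: "\<bar>L_fun z w\<bar> \<le> 3 * (norm z + norm w) powr 2"
proof -
  define a b where "a = norm z" and "b = norm w"
  have ab: "0 \<le> a" "0 \<le> b" by (simp_all add: a_def b_def)
  have "\<bar>L_fun z w\<bar> \<le> 3 * (a + b)\<^sup>2"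
  proof (cases "a + b \<le> 1")
    case True
    have "a\<^sup>2 \<le> (a + b)\<^sup>2" "b\<^sup>2 \<le> (a + b)\<^sup>2" using ab by (auto intro!: power_mono)
    then have "\<bar>a\<^sup>2 - b\<^sup>2\<bar> \<le> 3 * (a + b)\<^sup>2" using zero_le_power2[of a] zero_le_power2[of b] by linarith
    then show ?thesis using True by (simp add: L_fun_def a_def b_def)
  next
    case False
    then have "a + b \<le> (a + b)\<^sup>2" by (simp add: power2_eq_square)
    then have "\<bar>2 * a - 1\<bar> \<le> 3 * (a + b)\<^sup>2" using False ab by linarith
    then show ?thesis using False by (simp add: L_fun_def a_def b_def)
  qed
  then show ?thesis using ab by (simp add: a_def b_def)
qed

text \<open>The function \<open>k\<close> for the integrand \<open>L\<close>. For \<open>s \<le> 1\<close> tangency forces \<open>k' s = s\<close>; beyond,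
  the integrand is \<open>t + s - 1\<close> for \<open>t \<ge> - s\<close>, with slope \<open>k' s = 1\<close>.\<close>

definition huber :: "real \<Rightarrow> real" where
  "huber s = (if s \<le> 1 then s\<^sup>2 / 2 else s - 1 / 2)"

text \<open>The derivative \<open>min s 1\<close> is \<open>1\<close>-Lipschitz, so the first order remainder lies between \<open>0\<close> and
  \<open>(y - s)\<^sup>2 / 2\<close>. This treats the junction at \<open>1\<close> together with all other points.\<close>

lemma huber_derivative: "(huber has_real_derivative min s 1) (at s)"
proof -
  have rem: "0 \<le> huber y - huber s - min s 1 * (y - s) \<and> huber y - huber s - min s 1 * (y - s) \<le> (y - s)\<^sup>2 / 2" for y
  proof -
    have *: "(y - s)\<^sup>2 / 2 \<ge> 0" "(y - 1)\<^sup>2 / 2 \<ge> 0" "(1 - s)\<^sup>2 / 2 \<ge> 0" by simp_all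
    consider "s \<le> 1" "y \<le> 1" | "s \<le> 1" "1 < y" | "1 < s" "y \<le> 1" | "1 < s" "1 < y" by linarith
    then show ?thesis
    proof cases
      case 1
      then have "huber y - huber s - min s 1 * (y - s) = (y - s)\<^sup>2 / 2"
        by (simp add: huber_def min_def power2_eq_square field_simps)
      with * show ?thesis by linarith
    next
      case 2
      then have "huber y - huber s - min s 1 * (y - s) = (y - s)\<^sup>2 / 2 - (y - 1)\<^sup>2 / 2"
        by (simp add: huber_def min_def power2_eq_square field_simps)
      moreover have "(y - 1)\<^sup>2 \<le> (y - s)\<^sup>2" using 2 by (intro power_mono) auto
      ultimately show ?thesis using * by linarith
    next
      case 3
      then have "huber y - huber s - min s 1 * (y - s) = (1 - y)\<^sup>2 / 2"
        by (simp add: huber_def min_def power2_eq_square field_simps)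
      moreover have "(1 - y)\<^sup>2 \<le> (s - y)\<^sup>2" using 3 by (intro power_mono) auto
      ultimately show ?thesis using zero_le_power2[of "1 - y"] power2_commute[of y s] by linarith
    next
      case 4
      then show ?thesis using * by (simp add: huber_def min_def)
    qed
  qed
  have "((\<lambda>y. (huber y - huber s) / (y - s) - min s 1) \<longlongrightarrow> 0) (at s)"
  proof (rule Lim_null_comparison)
    show "\<forall>\<^sub>F y in at s. norm ((huber y - huber s) / (y - s) - min s 1) \<le> \<bar>y - s\<bar>"
      unfolding eventually_at_filter
    proof (intro always_eventually allI impI)
      fix y assume "y \<noteq> s"
      have "\<bar>huber y - huber s - min s 1 * (y - s)\<bar> \<le> \<bar>y - s\<bar> * \<bar>y - s\<bar>"
        using rem[of y] zero_le_power2[of "y - s"] by (simp add: power2_eq_square abs_mult[symmetric])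
      moreover have "(huber y - huber s) / (y - s) - min s 1 = (huber y - huber s - min s 1 * (y - s)) / (y - s)"
        using \<open>y \<noteq> s\<close> by (simp add: field_simps)
      ultimately show "norm ((huber y - huber s) / (y - s) - min s 1) \<le> \<bar>y - s\<bar>"
        using \<open>y \<noteq> s\<close> by (simp add: abs_divide divide_le_eq)
    qed
    show "((\<lambda>y. \<bar>y - s\<bar>) \<longlongrightarrow> 0) (at s)" by (auto intro!: tendsto_eq_intros)
  qed
  then show ?thesis unfolding has_field_derivative_iff by (rule LIM_zero_cancel)
qed

lemma half_abs_sum_eq_max:
  fixes s t :: real
  assumes "0 \<le> s"
  shows "\<bar>t + s\<bar> / 2 + \<bar>t - s\<bar> / 2 = max \<bar>t\<bar> s"
proof -
  have "\<bar>t + s\<bar> + \<bar>t - s\<bar> = 2 * max \<bar>t\<bar> s" using assms by linarith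
  then show ?thesis by (simp add: field_simps)
qed

text \<open>In terms of \<open>s\<close> and \<open>t\<close> the integrand is \<open>t * s\<close> when \<open>max \<bar>t\<bar> s \<le> 1\<close> and \<open>\<bar>t + s\<bar> - 1\<close> otherwise. For
  \<open>s \<le> 1\<close> the left-hand side is \<open>s * t\<close>, and the gap is a product of two factors of equal sign;
  for \<open>s > 1\<close> the left-hand side is \<open>t + s - 1\<close>.\<close>

lemma L_fun_tangent:
  assumes s: "0 \<le> s" and z: "norm z = \<bar>t + s\<bar> / 2" and w: "norm w = \<bar>t - s\<bar> / 2"
  shows "2 * huber s - s * min s 1 + min s 1 * t \<le> L_fun z w"
proof -
  have sum: "norm z + norm w = max \<bar>t\<bar> s" unfolding z w using s by (rule half_abs_sum_eq_max)
  have diff: "(norm z)\<^sup>2 - (norm w)\<^sup>2 = t * s"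
    unfolding z w by (simp add: power_divide power2_eq_square field_simps)
  show ?thesis
  proof (cases "s \<le> 1")
    case s1: True
    have lhs: "2 * huber s - s * min s 1 + min s 1 * t = s * t"
      using s1 by (simp add: huber_def power2_eq_square)
    show ?thesis
    proof (cases "\<bar>t\<bar> \<le> 1")
      case True
      then show ?thesis using s1 sum diff lhs by (simp add: L_fun_def)
    next
      case False
      then have L: "L_fun z w = \<bar>t + s\<bar> - 1" using s1 sum z by (simp add: L_fun_def)
      have "s * t \<le> \<bar>t + s\<bar> - 1"
      proof (cases "1 < t")
        case True
        then have "0 \<le> (t - 1) * (1 - s)" using s1 by (intro mult_nonneg_nonneg) auto
        then show ?thesis using True s by (simp add: algebra_simps)
      next
        case tn: False
        then have "0 \<le> (- t - 1) * (1 + s)" using False s by (intro mult_nonneg_nonneg) auto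
        then show ?thesis using tn False s s1 by (simp add: algebra_simps)
      qed
      then show ?thesis using lhs L by simp
    qed
  next
    case False
    then have "\<not> norm z + norm w \<le> 1" using sum by linarith
    then have "L_fun z w = \<bar>t + s\<bar> - 1" using z by (simp add: L_fun_def)
    then show ?thesis using False by (simp add: huber_def)
  qed
qed

section \<open>The integrand of Burkholder type\<close>

text \<open>Monotonicity on \<open>[1, \<infinity>)\<close> of the expressions to which the one-variable inequality reduces for
  \<open>\<bar>x\<bar> \<ge> 1\<close>; the hypothesis is the sign of the derivative.\<close>

lemma powr_polynomial_mono:
  fixes A B E p u :: real
  assumes u: "1 \<le> u"
    and deriv: "\<And>x. 1 \<le> x \<Longrightarrow> 0 \<le> A * p * x powr (p - 1) + B * (p - 1) * x powr (p - 2) + E"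
  shows "A + B + E \<le> (A * u + B) * u powr (p - 1) + E * u"
proof -
  define F where "F x = (A * x + B) * x powr (p - 1) + E * x" for x
  have "F 1 \<le> F u"
  proof (rule DERIV_nonneg_imp_nondecreasing[OF u])
    fix x :: real assume x: "1 \<le> x" "x \<le> u"
    have pow: "x * x powr (p - 2) = x powr (p - 1)"
      using x powr_add[of x 1 "p - 2"] by (simp add: algebra_simps)
    have "(F has_real_derivative A * x powr (p - 1) + ((p - 1) * x powr (p - 1 - 1)) * (A * x + B) + E) (at x)"
      unfolding F_def by (rule derivative_eq_intros refl | use x in force)+
    moreover have "A * x powr (p - 1) + ((p - 1) * x powr (p - 1 - 1)) * (A * x + B) + E
        = A * p * x powr (p - 1) + B * (p - 1) * x powr (p - 2) + E"
      using pow by (simp add: algebra_simps)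
    ultimately show "\<exists>y. (F has_real_derivative y) (at x) \<and> 0 \<le> y"
      using deriv[OF x(1)] by auto
  qed
  then show ?thesis by (simp add: F_def)
qed

text \<open>On \<open>[-1, 1]\<close> the right-hand side is affine with the same slope \<open>p\<close>. Beyond \<open>1\<close> the factor
  \<open>x powr (p - 1)\<close> is at least \<open>x\<close>. Below \<open>- 1\<close> the derivative in \<open>u = - x\<close> has the right sign by Young's
  inequality, which interpolates the exponent \<open>p - 2\<close> between \<open>p - 1\<close> and \<open>0\<close>.\<close>

lemma burkholder_tangent_ge_2:
  fixes p x :: real
  assumes p: "2 \<le> p"
  shows "2 - p + p * x \<le> ((p - 1) * \<bar>x + 1\<bar> - \<bar>x - 1\<bar>) * max \<bar>x\<bar> 1 powr (p - 1)"
proof -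
  consider "\<bar>x\<bar> \<le> 1" | "1 < x" | "x < -1" by linarith
  then show ?thesis
  proof cases
    case 1
    then have "\<bar>x + 1\<bar> = x + 1" "\<bar>x - 1\<bar> = 1 - x" by auto
    then have "(p - 1) * \<bar>x + 1\<bar> - \<bar>x - 1\<bar> = p - 2 + p * x" by (simp add: algebra_simps)
    then show ?thesis using 1 p by (simp add: max_absorb2)
  next
    case 2
    have "x powr 1 \<le> x powr (p - 1)" using 2 p by (intro powr_mono) auto
    then have "((p - 2) * x + p) * x \<le> ((p - 2) * x + p) * x powr (p - 1)"
      using 2 p by (intro mult_left_mono) auto
    moreover have "2 - p + p * x \<le> ((p - 2) * x + p) * x"
    proof -
      have "0 \<le> (p - 2) * (x * x + 1)" using p by (intro mult_nonneg_nonneg) auto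
      then show ?thesis by (simp add: algebra_simps)
    qed
    moreover have "(p - 1) * \<bar>x + 1\<bar> - \<bar>x - 1\<bar> = (p - 2) * x + p" using 2 by (simp add: algebra_simps)
    ultimately show ?thesis using 2 by (simp add: max_absorb1)
  next
    case 3
    define u where "u = - x"
    have "(p - 2) + (- p) + p \<le> ((p - 2) * u + - p) * u powr (p - 1) + p * u"
    proof (rule powr_polynomial_mono)
      fix y :: real assume y: "1 \<le> y"
      have "(y powr (p - 1)) powr ((p - 2) / (p - 1)) * 1 powr (1 / (p - 1)) \<le> (p - 2) / (p - 1) * y powr (p - 1) + 1 / (p - 1) * 1"
        using p y by (intro Youngs_inequality_0) (auto simp: field_simps)
      then have "y powr (p - 2) \<le> ((p - 2) * y powr (p - 1) + 1) / (p - 1)"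
        using p by (simp add: powr_powr add_divide_distrib)
      then have "(p - 1) * y powr (p - 2) \<le> (p - 2) * y powr (p - 1) + 1"
        using p by (simp add: field_simps)
      then have "0 \<le> p * ((p - 2) * y powr (p - 1) + 1 - (p - 1) * y powr (p - 2))"
        using p by (intro mult_nonneg_nonneg) auto
      then show "0 \<le> (p - 2) * p * y powr (p - 1) + - p * (p - 1) * y powr (p - 2) + p"
        by (simp add: algebra_simps)
    qed (use 3 in \<open>simp add: u_def\<close>)
    moreover have "(p - 1) * \<bar>x + 1\<bar> - \<bar>x - 1\<bar> = (p - 2) * u + - p" using 3 by (simp add: u_def algebra_simps)
    ultimately show ?thesis using 3 p by (simp add: u_def max_absorb1)
  qed
qed

text \<open>On \<open>[-1, 1]\<close> this is an equality. For \<open>x > 1\<close> the sign of the derivative is Young's inequality with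
  weights \<open>2 - p\<close> and \<open>p - 1\<close>, for which the powers cancel to \<open>1\<close>; for \<open>x < - 1\<close> it follows from
  \<open>y powr (p - 2) \<le> 1\<close>.\<close>

lemma burkholder_tangent_le_2:
  fixes p x :: real
  assumes p: "1 < p" "p \<le> 2"
  shows "2 - p + p * x \<le> (\<bar>x + 1\<bar> - (p - 1) * \<bar>x - 1\<bar>) * max \<bar>x\<bar> 1 powr (p - 1)"
proof -
  consider "\<bar>x\<bar> \<le> 1" | "1 < x" | "x < -1" by linarith
  then show ?thesis
  proof cases
    case 1
    then have "\<bar>x + 1\<bar> = x + 1" "\<bar>x - 1\<bar> = 1 - x" by auto
    then have "\<bar>x + 1\<bar> - (p - 1) * \<bar>x - 1\<bar> = 2 - p + p * x" by (simp add: algebra_simps)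
    then show ?thesis using 1 by (simp add: max_absorb2)
  next
    case 2
    have "(2 - p) + p + - p \<le> ((2 - p) * x + p) * x powr (p - 1) + - p * x"
    proof (rule powr_polynomial_mono)
      fix y :: real assume y: "1 \<le> y"
      have "(y powr (p - 1)) powr (2 - p) * (y powr (p - 2)) powr (p - 1) \<le> (2 - p) * y powr (p - 1) + (p - 1) * y powr (p - 2)"
        using p y by (intro Youngs_inequality_0) auto
      moreover have "(y powr (p - 1)) powr (2 - p) * (y powr (p - 2)) powr (p - 1) = 1"
        using y by (simp add: powr_powr flip: powr_add) (simp add: algebra_simps)
      ultimately have "0 \<le> p * ((2 - p) * y powr (p - 1) + (p - 1) * y powr (p - 2) - 1)"
        using p by (intro mult_nonneg_nonneg) auto
      then show "0 \<le> (2 - p) * p * y powr (p - 1) + p * (p - 1) * y powr (p - 2) + - p"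
        by (simp add: algebra_simps)
    qed (use 2 in simp)
    moreover have "\<bar>x + 1\<bar> - (p - 1) * \<bar>x - 1\<bar> = (2 - p) * x + p" using 2 by (simp add: algebra_simps)
    ultimately show ?thesis using 2 by (simp add: max_absorb1)
  next
    case 3
    define u where "u = - x"
    have "(2 - p) + (- p) + p \<le> ((2 - p) * u + - p) * u powr (p - 1) + p * u"
    proof (rule powr_polynomial_mono)
      fix y :: real assume y: "1 \<le> y"
      have "y powr (p - 2) \<le> y powr 0" using y p by (intro powr_mono) auto
      then have "(p - 1) * y powr (p - 2) \<le> 1 * 1" using p y by (intro mult_mono) auto
      moreover have "0 \<le> (2 - p) * y powr (p - 1)" using p by simp
      ultimately have "0 \<le> (2 - p) * y powr (p - 1) + 1 - (p - 1) * y powr (p - 2)" by linarith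
      then have "0 \<le> p * ((2 - p) * y powr (p - 1) + 1 - (p - 1) * y powr (p - 2))"
        using p by (intro mult_nonneg_nonneg) auto
      then show "0 \<le> (2 - p) * p * y powr (p - 1) + - p * (p - 1) * y powr (p - 2) + p"
        by (simp add: algebra_simps)
    qed (use 3 in \<open>simp add: u_def\<close>)
    moreover have "\<bar>x + 1\<bar> - (p - 1) * \<bar>x - 1\<bar> = (2 - p) * u + - p" using 3 by (simp add: u_def algebra_simps)
    ultimately show ?thesis using 3 p by (simp add: u_def max_absorb1)
  qed
qed

text \<open>At \<open>s = 0\<close> the derivative is one-sided; this is the value that matters where \<open>g\<close> vanishes.\<close>

lemma DERIV_powr_within_nonneg:
  fixes p s :: real
  assumes p: "1 < p" and s: "0 \<le> s"
  shows "((\<lambda>s. s powr p) has_real_derivative p * s powr (p - 1)) (at s within {0..})"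
proof (cases "s = 0")
  case False
  then show ?thesis using s by (intro DERIV_subset[OF has_real_derivative_powr]) auto
next
  case True
  have "((\<lambda>y::real. y powr (p - 1)) \<longlongrightarrow> 0 powr (p - 1)) (at 0 within {0..})"
    by (rule tendsto_powr') (use p in \<open>auto intro!: tendsto_eq_intros simp: eventually_at_filter\<close>)
  then have "((\<lambda>y::real. (y powr p - 0 powr p) / (y - 0)) \<longlongrightarrow> 0) (at 0 within {0..})"
  proof (simp, elim Lim_transform_eventually)
    show "\<forall>\<^sub>F y::real in at 0 within {0..}. y powr (p - 1) = y powr p / y"
      unfolding eventually_at_filter by (auto simp: powr_diff)
  qed
  then show ?thesis using True by (simp add: has_field_derivative_iff)
qed

lemma pstar_ge_2: "1 < p \<Longrightarrow> 2 \<le> pstar p"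
  by (auto simp: pstar_def max_def field_simps)

lemma alpha_pos:
  assumes "1 < p" shows "0 < alpha p"
  using pstar_ge_2[OF assms] assms by (simp add: alpha_def)

lemma Phi_bound:
  assumes p: "1 < p"
  shows "\<bar>Phi p z w\<bar> \<le> alpha p * (pstar p - 1) * (norm z + norm w) powr p"
proof -
  define a b q where "a = norm z" and "b = norm w" and "q = pstar p - 1"
  have ab: "0 \<le> a" "0 \<le> b" and q: "1 \<le> q" using pstar_ge_2[OF p] by (simp_all add: a_def b_def q_def)
  have "0 \<le> q * a" "b \<le> q * b" using q ab by (auto simp: mult_le_cancel_right1)
  then have "\<bar>q * a - b\<bar> \<le> q * (a + b)" using ab by (simp add: algebra_simps abs_le_iff)
  then have "alpha p * \<bar>q * a - b\<bar> * (a + b) powr (p - 1) \<le> alpha p * (q * (a + b)) * (a + b) powr (p - 1)"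
    using alpha_pos[OF p] by (intro mult_right_mono mult_left_mono) auto
  also have "\<dots> = alpha p * q * (a + b) powr p" using ab powr_mult_base[of "a + b" "p - 1"] by simp
  finally show ?thesis using alpha_pos[OF p] by (simp add: Phi_def a_def b_def q_def abs_mult)
qed

text \<open>The factor in \<open>k s = burkholder_coeff p * s powr p\<close>. The extra \<open>1 / (p - 1)\<close> for \<open>p < 2\<close> is the value
  of \<open>p\<^sup>* - 1\<close> there, which the corresponding one-variable inequality has been cleared of.\<close>

definition burkholder_coeff :: "real \<Rightarrow> real" where
  "burkholder_coeff p = alpha p / 2 * (if 2 \<le> p then 1 else 1 / (p - 1))"

text \<open>Both sides are homogeneous of degree \<open>p\<close> in \<open>(s, t)\<close>. For \<open>s > 0\<close> dividing by \<open>s powr p\<close> leaves the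
  one-variable inequality at \<open>x = t / s\<close>; for \<open>s = 0\<close> the left-hand side vanishes and the right-hand side
  is nonnegative because \<open>p\<^sup>* \<ge> 2\<close>.\<close>

lemma Phi_tangent:
  assumes p: "1 < p" and s: "0 \<le> s" and z: "norm z = \<bar>t + s\<bar> / 2" and w: "norm w = \<bar>t - s\<bar> / 2"
  shows "2 * (burkholder_coeff p * s powr p) - s * (burkholder_coeff p * (p * s powr (p - 1)))
      + burkholder_coeff p * (p * s powr (p - 1)) * t \<le> Phi p z w"
proof -
  define q where "q = pstar p - 1"
  define c where "c = (if 2 \<le> p then 1 else 1 / (p - 1))"
  have q: "1 \<le> q" using pstar_ge_2[OF p] by (simp add: q_def)
  have bc: "burkholder_coeff p = alpha p / 2 * c" by (simp add: burkholder_coeff_def c_def)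
  have sum: "norm z + norm w = max \<bar>t\<bar> s" unfolding z w using s by (rule half_abs_sum_eq_max)
  have Phi: "Phi p z w = alpha p / 2 * ((q * \<bar>t + s\<bar> - \<bar>t - s\<bar>) * max \<bar>t\<bar> s powr (p - 1))"
    unfolding Phi_def sum by (simp add: z w q_def field_simps)
  have reduced: "c * (2 - p + p * x) \<le> (q * \<bar>x + 1\<bar> - \<bar>x - 1\<bar>) * max \<bar>x\<bar> 1 powr (p - 1)" for x
  proof (cases "2 \<le> p")
    case True
    then have "p / (p - 1) \<le> p" by (simp add: field_simps)
    then have "q = p - 1" by (simp add: q_def pstar_def max_def)
    then show ?thesis using burkholder_tangent_ge_2[OF True, of x] True by (simp add: c_def)
  next
    case False
    then have "p \<le> p / (p - 1)" using p by (simp add: field_simps)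
    then have q_eq: "q = 1 / (p - 1)" using p by (simp add: q_def pstar_def max_def field_simps)
    have "1 / (p - 1) * (2 - p + p * x) \<le> 1 / (p - 1) * ((\<bar>x + 1\<bar> - (p - 1) * \<bar>x - 1\<bar>) * max \<bar>x\<bar> 1 powr (p - 1))"
      using burkholder_tangent_le_2[of p x] p False by (intro mult_left_mono) auto
    also have "\<dots> = (q * \<bar>x + 1\<bar> - \<bar>x - 1\<bar>) * max \<bar>x\<bar> 1 powr (p - 1)"
      using p by (simp add: q_eq field_simps)
    finally show ?thesis using False by (simp add: c_def)
  qed
  have a: "0 \<le> alpha p / 2" using alpha_pos[OF p] by simp
  show ?thesis
  proof (cases "s = 0")
    case True
    have "0 \<le> (q * \<bar>t\<bar> - \<bar>t\<bar>) * max \<bar>t\<bar> 0 powr (p - 1)"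
      using q by (intro mult_nonneg_nonneg) (auto simp: mult_le_cancel_right1)
    then show ?thesis using True a p unfolding Phi by (simp add: zero_le_mult_iff)
  next
    case False
    then have s: "0 < s" using s by simp
    define x where "x = t / s"
    have t: "t = s * x" using s by (simp add: x_def)
    have sp: "s * s powr (p - 1) = s powr p" using s by (simp add: powr_diff)
    have "2 * (c * s powr p) - s * (c * (p * s powr (p - 1))) + c * (p * s powr (p - 1)) * t = s powr p * (c * (2 - p + p * x))"
      unfolding t sp[symmetric] by (simp add: algebra_simps)
    also have "\<dots> \<le> s powr p * ((q * \<bar>x + 1\<bar> - \<bar>x - 1\<bar>) * max \<bar>x\<bar> 1 powr (p - 1))"
      using reduced by (intro mult_left_mono) auto
    also have "\<dots> = (q * (s * \<bar>x + 1\<bar>) - s * \<bar>x - 1\<bar>) * (s powr (p - 1) * max \<bar>x\<bar> 1 powr (p - 1))"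
      unfolding sp[symmetric] by (simp add: algebra_simps)
    also have "\<dots> = (q * \<bar>t + s\<bar> - \<bar>t - s\<bar>) * max \<bar>t\<bar> s powr (p - 1)"
    proof -
      have "s * \<bar>x + 1\<bar> = \<bar>t + s\<bar>" "s * \<bar>x - 1\<bar> = \<bar>t - s\<bar>"
        using s abs_mult[of s "x + 1"] abs_mult[of s "x - 1"] by (simp_all add: t distrib_left right_diff_distrib)
      moreover have "s * max \<bar>x\<bar> 1 = max \<bar>t\<bar> s"
        using s by (simp add: t max_mult_distrib_left abs_mult)
      moreover have "s powr (p - 1) * max \<bar>x\<bar> 1 powr (p - 1) = (s * max \<bar>x\<bar> 1) powr (p - 1)"
        using s by (simp add: powr_mult)
      ultimately show ?thesis by (simp only:)
    qed
    finally have "alpha p / 2 * (2 * (c * s powr p) - s * (c * (p * s powr (p - 1))) + c * (p * s powr (p - 1)) * t) \<le> Phi p z w"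
      unfolding Phi using a by (intro mult_left_mono)
    then show ?thesis unfolding bc by (simp add: algebra_simps)
  qed
qed

section \<open>Quasiconvexity at zero along stretch functions\<close>

theorem theorem2:
  "(\<forall>f df dbarf. f \<in> stretch_functions \<inter> hom_sobolev 2 \<and> has_weak_d f df \<and> has_weak_dbar f dbarf \<longrightarrow>
      integrable lebesgue (\<lambda>z. L_fun (df z) (dbarf z)) \<and>
      (LINT z|lebesgue. L_fun (df z) (dbarf z)) \<ge> 0) \<and>
   (\<forall>p f df dbarf. 1 < p \<and> f \<in> stretch_functions \<inter> hom_sobolev p \<and>
        has_weak_d f df \<and> has_weak_dbar f dbarf \<longrightarrow>
      integrable lebesgue (\<lambda>z. Phi p (df z) (dbarf z)) \<and>
      (LINT z|lebesgue. Phi p (df z) (dbarf z)) \<ge> 0)"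
proof (intro conjI allI impI; elim conjE IntE)
  fix f df dbarf
  assume f: "f \<in> stretch_functions" "f \<in> hom_sobolev 2" and d: "has_weak_d f df" "has_weak_dbar f dbarf"
  obtain g where g: "stretch_profile g" "f = stretch_profile.stretch g"
    using stretch_functions_profile[OF f(1)] .
  have k: "(huber has_real_derivative min s 1) (at s within {0..})" for s
    using huber_derivative by (rule has_field_derivative_at_within)
  have k': "continuous_on {0..} (\<lambda>s::real. min s 1)" by (intro continuous_intros)
  have kb: "0 \<le> huber s \<and> huber s \<le> 1 * s powr 2" if "0 \<le> s" for s
  proof -
    have "0 \<le> (s - 1)\<^sup>2" by simp
    then show ?thesis using that by (auto simp: huber_def power2_eq_square algebra_simps)
  qed
  have meas: "(\<lambda>z. L_fun (df z) (dbarf z)) \<in> borel_measurable lebesgue"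
    if [measurable]: "df \<in> borel_measurable lebesgue" "dbarf \<in> borel_measurable lebesgue"
    unfolding L_fun_def by measurable
  have two: "0 < (2::real)" by simp
  note main = stretch_profile.gradient_functional_nonneg[OF g(1) two f(2)[unfolded g(2)] d[unfolded g(2)] k k' kb meas L_fun_bound L_fun_tangent]
  show "integrable lebesgue (\<lambda>z. L_fun (df z) (dbarf z))"
    and "(LINT z|lebesgue. L_fun (df z) (dbarf z)) \<ge> 0"
    by (rule main; assumption)+
next
  fix p :: real and f df dbarf
  assume p: "1 < p" and f: "f \<in> stretch_functions" "f \<in> hom_sobolev p" and d: "has_weak_d f df" "has_weak_dbar f dbarf"
  obtain g where g: "stretch_profile g" "f = stretch_profile.stretch g"
    using stretch_functions_profile[OF f(1)] .
  define c where "c = burkholder_coeff p"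
  have c: "0 \<le> c" using alpha_pos[OF p] p by (simp add: c_def burkholder_coeff_def)
  have k: "((\<lambda>s. c * s powr p) has_real_derivative c * (p * s powr (p - 1))) (at s within {0..})" if "0 \<le> s" for s
    by (rule DERIV_cmult[OF DERIV_powr_within_nonneg[OF p that]])
  have k': "continuous_on {0..} (\<lambda>s. c * (p * s powr (p - 1)))"
    using p by (intro continuous_intros continuous_on_powr') auto
  have kb: "0 \<le> c * s powr p \<and> c * s powr p \<le> c * s powr p" for s using c by simp
  have meas: "(\<lambda>z. Phi p (df z) (dbarf z)) \<in> borel_measurable lebesgue"
    if [measurable]: "df \<in> borel_measurable lebesgue" "dbarf \<in> borel_measurable lebesgue"
    unfolding Phi_def by measurable
  have p0: "0 < p" using p by simp
  note main = stretch_profile.gradient_functional_nonneg[OF g(1) p0 f(2)[unfolded g(2)] d[unfolded g(2)] k k' kb meas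
      Phi_bound[OF p] Phi_tangent[OF p, folded c_def]]
  show "integrable lebesgue (\<lambda>z. Phi p (df z) (dbarf z))"
    and "(LINT z|lebesgue. Phi p (df z) (dbarf z)) \<ge> 0"
    by (rule main; assumption)+
qed

end
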